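(* The superextension $\lambda(X)$ of a regular semigroup $X$ is commutative if and only if one of the following conditions holds: (i) $X$ is isomorphic to one of the semigroups: $C_2$, $C_3$, $C_4$, $C_2\times C_2$, $C_2\times L_2$, $L_1\sqcup C_2$, or $C_2\sqcup L_n$ for some $n\in\mathbb N$; (ii) $X=\bigvee_{\alpha\in A}X_\alpha$ is a $0$-bouquet of some subsemigroups $X_\alpha$, $\alpha\in A$, each of which is isomorphic to $L_1\sqcup C_2$ or to $L_n$ for some $n\in\mathbb N$.
   Context: $\mathbb N=\{1,2,3,\dots\}$. An upfamily on a nonempty set $X$ is a nonempty family $\mathcal F$ of nonempty subsets of $X$ such that $F\in\mathcal F$ and $F\subset E\subset X$ imply $E\in\mathcal F$; $\upsilon(X)$ is the set of all upfamilies on $X$. A family $\mathcal G$ of nonempty subsets of $X$ generates the upfamily $\langle G:G\in\mathcal G\rangle=\{E\subset X:\exists G\in\mathcal G,\ G\subset E\}$. An upfamily $\mathcal F$ is linked if $A\cap B\ne\emptyset$ for all $A,B\in\mathcal F$; it is maximal linked if it is linked and coincides with every linked upfamily containing it. $\lambda(X)$ (the superextension) is the set of maximal linked upfamilies; for a semigroup $X$ it is a semigroup under the associative operation $\mathcal A*\mathcal B=\langle\bigcup_{a\in A}aB_a: A\in\mathcal A,\ (B_a)_{a\in A}\in\mathcal B^A\rangle$, and commutativity of $\lambda(X)$ refers to $*$. A semigroup $X$ is regular if $x\in xXx$ for every $x\in X$. $C_n=\{z\in\mathbb C:z^n=1\}$ is the cyclic group of order $n$; $L_n=\{0,\dots,n-1\}$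 is the linear semilattice with operation $\min$. For semigroups $(X,* )$ and $(Y,\star)$ the ordered union $X\sqcup Y$ is $X\times\{0\}\cup Y\times\{1\}$ with the operation $(a,0)\circ(b,0)=(a*b,0)$, $(a,0)\circ(b,1)=(a,0)$, $(a,1)\circ(b,0)=(b,0)$, $(a,1)\circ(b,1)=(a\star b,1)$. A semigroup $X$ is a $0$-bouquet of its subsemigroups $X_\alpha$, $\alpha\in I$, written $X=\bigvee_{\alpha\in I}X_\alpha$, if $X=\bigcup_{\alpha\in I}X_\alpha$, $X$ has a two-sided zero $0$, and $X_\alpha\cap X_\beta=X_\alpha X_\beta=\{0\}$ for any distinct $\alpha,\beta\in I$. *)

theory Defs
  imports Complex_Main "HOL-Library.FuncSet" "HOL-Algebra.Congruence"
begin

section \<open>Semigroups with an explicit carrier\<close>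

record 'a magma = "'a partial_object" +
  sop :: "'a \<Rightarrow> 'a \<Rightarrow> 'a" (infixl \<open>\<star>\<index>\<close> 70)

locale carrier_semigroup =
  fixes X :: "'a magma" (structure)
  assumes nonempty: "carrier X \<noteq> {}"
    and closed: "\<lbrakk>x \<in> carrier X; y \<in> carrier X\<rbrakk> \<Longrightarrow> x \<star> y \<in> carrier X"
    and assoc: "\<lbrakk>x \<in> carrier X; y \<in> carrier X; z \<in> carrier X\<rbrakk>
      \<Longrightarrow> (x \<star> y) \<star> z = x \<star> (y \<star> z)"

definition regular :: "'a magma \<Rightarrow> bool" where
  "regular X \<longleftrightarrow>
    (\<forall>x\<in>carrier X. \<exists>y\<in>carrier X. x = (x \<star>\<^bsub>X\<^esub> y) \<star>\<^bsub>X\<^esub> x)"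

definition commutative :: "'a magma \<Rightarrow> bool" where
  "commutative X \<longleftrightarrow>
    (\<forall>x\<in>carrier X. \<forall>y\<in>carrier X. x \<star>\<^bsub>X\<^esub> y = y \<star>\<^bsub>X\<^esub> x)"

definition isomorphic :: "'a magma \<Rightarrow> 'b magma \<Rightarrow> bool" where
  "isomorphic X Y \<longleftrightarrow>
    (\<exists>f. bij_betw f (carrier X) (carrier Y) \<and>
      (\<forall>x\<in>carrier X. \<forall>y\<in>carrier X. f (x \<star>\<^bsub>X\<^esub> y) = f x \<star>\<^bsub>Y\<^esub> f y))"

definition subsemigroup :: "'a set \<Rightarrow> 'a magma \<Rightarrow> bool" where
  "subsemigroup S X \<longleftrightarrow>
    S \<noteq> {} \<and> S \<subseteq> carrier X \<and> (\<forall>x\<in>S. \<forall>y\<in>S. x \<star>\<^bsub>X\<^esub> y \<in> S)"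

definition is_zero :: "'a magma \<Rightarrow> 'a \<Rightarrow> bool" where
  "is_zero X z \<longleftrightarrow>
    z \<in> carrier X \<and> (\<forall>x\<in>carrier X. z \<star>\<^bsub>X\<^esub> x = z \<and> x \<star>\<^bsub>X\<^esub> z = z)"


section \<open>The semigroups in the classification\<close>

definition cyclic_group :: "nat \<Rightarrow> complex magma" where
  "cyclic_group n = \<lparr>carrier = {z. z ^ n = 1}, sop = (*)\<rparr>"

definition linear_semilattice :: "nat \<Rightarrow> nat magma" where
  "linear_semilattice n = \<lparr>carrier = {0..<n}, sop = min\<rparr>"

definition direct_product :: "'a magma \<Rightarrow> 'b magma \<Rightarrow> ('a \<times> 'b) magma" where
  "direct_product X Y =
    \<lparr>carrier = carrier X \<times> carrier Y,
     sop = (\<lambda>(a, b) (c, d). (a \<star>\<^bsub>X\<^esub> c, b \<star>\<^bsub>Y\<^esub> d))\<rparr>"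

fun ordered_union_op :: "'a magma \<Rightarrow> 'b magma \<Rightarrow> 'a + 'b \<Rightarrow> 'a + 'b \<Rightarrow> 'a + 'b" where
  "ordered_union_op X Y (Inl a) (Inl b) = Inl (a \<star>\<^bsub>X\<^esub> b)"
| "ordered_union_op X Y (Inl a) (Inr b) = Inl a"
| "ordered_union_op X Y (Inr a) (Inl b) = Inl b"
| "ordered_union_op X Y (Inr a) (Inr b) = Inr (a \<star>\<^bsub>Y\<^esub> b)"

text \<open>The tags \<^const>\<open>Inl\<close> and \<^const>\<open>Inr\<close> play the roles of the second coordinates 0 and 1
  in the disjoint union of \<open>X \<times> {0}\<close> and \<open>Y \<times> {1}\<close>; the factors may have different types.\<close>

definition ordered_union :: "'a magma \<Rightarrow> 'b magma \<Rightarrow> ('a + 'b) magma" where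
  "ordered_union X Y =
    \<lparr>carrier = carrier X <+> carrier Y, sop = ordered_union_op X Y\<rparr>"

text \<open>Instantiating the index type \<open>'i\<close> with \<open>'a set\<close> already captures bouquets over arbitrary
  index sets: a family can be indexed by its own members, and distinct indices with the same
  member force that member to be the zero alone.\<close>

definition zero_bouquet :: "'a magma \<Rightarrow> 'i set \<Rightarrow> ('i \<Rightarrow> 'a set) \<Rightarrow> bool" where
  "zero_bouquet X I S \<longleftrightarrow>
    (\<forall>i\<in>I. subsemigroup (S i) X) \<and>
    carrier X = (\<Union>i\<in>I. S i) \<and>
    (\<exists>z. is_zero X z \<and>
      (\<forall>i\<in>I. \<forall>j\<in>I. i \<noteq> j \<longrightarrow>
        S i \<inter> S j = {z} \<and> {x \<star>\<^bsub>X\<^esub> y | x y. x \<in> S i \<and> y \<in> S j} = {z}))"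


section \<open>Upfamilies and the superextension\<close>

definition upfamilies :: "'a set \<Rightarrow> 'a set set set" where
  "upfamilies X =
    {\<F>. \<F> \<noteq> {} \<and> \<F> \<subseteq> Pow X - {{}} \<and>
      (\<forall>F\<in>\<F>. \<forall>E. F \<subseteq> E \<and> E \<subseteq> X \<longrightarrow> E \<in> \<F>)}"

definition generated :: "'a set \<Rightarrow> 'a set set \<Rightarrow> 'a set set" where
  "generated X \<G> = {E. E \<subseteq> X \<and> (\<exists>G\<in>\<G>. G \<subseteq> E)}"

definition linked :: "'a set set \<Rightarrow> bool" where
  "linked \<F> \<longleftrightarrow> (\<forall>A\<in>\<F>. \<forall>B\<in>\<F>. A \<inter> B \<noteq> {})"

definition maximal_linked :: "'a set \<Rightarrow> 'a set set set" where
  "maximal_linked X =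
    {\<F> \<in> upfamilies X. linked \<F> \<and>
      (\<forall>\<G>\<in>upfamilies X. linked \<G> \<and> \<F> \<subseteq> \<G> \<longrightarrow> \<F> = \<G>)}"

definition upfamily_mult :: "'a magma \<Rightarrow> 'a set set \<Rightarrow> 'a set set \<Rightarrow> 'a set set" where
  "upfamily_mult X \<A> \<B> =
    generated (carrier X)
      {\<Union>a\<in>A. {a \<star>\<^bsub>X\<^esub> b | b. b \<in> B a} | A B. A \<in> \<A> \<and> B \<in> A \<rightarrow> \<B>}"

definition superextension :: "'a magma \<Rightarrow> 'a set set magma" where
  "superextension X =
    \<lparr>carrier = maximal_linked (carrier X), sop = upfamily_mult X\<rparr>"

end

(* The superextension is commutative iff X is commutative and there are no sets E, P, Q with
   (for all a in P some q in Q has a q in E), (any two a, a' in P have a common x with a x, a' x in E)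
   and the same two conditions with (E, P, Q) replaced by (complement of E, Q, P): such a crossing
   describes two linked families whose maximal linked extensions do not commute, and a pair of
   noncommuting maximal linked families yields one.

   A commutative regular semigroup is a semilattice of abelian groups. Crossings with P and Q of two
   elements exclude every configuration outside the list: groups of order at least five, groups of
   order at least three next to another idempotent, nontrivial groups in the wrong place, and two
   semilattices; a crossing of alternating terms excludes infinite chains of idempotents.

   Conversely the groups and the small semigroups are a finite Boolean check, and in the union of
   C_2 and a chain a crossing leads to an infinite descent. In a 0-bouquet one may assume that 0 is not
   in E; the common multipliers then force P into one component, which inherits the crossing. *)

theory Submission
  imports Defs
begin

section \<open>Crossings and noncommuting maximal linked families\<close>

text \<open>Linkedness only asks members to meet in pairs, so a crossing needs common multipliers
  for just two elements at a time. This makes crossings abundant and the list of survivors short. A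
  crossing uses no more of \<open>E\<close> than the products it names, so one with two-element
  \<open>P\<close> and \<open>Q\<close> amounts to the disjointness of two sets of four products,
  and it persists in every larger semigroup.

  The bouquets come from the two excluded semilattices: an incomparable pair of idempotents can have
  neither an idempotent strictly below its meet nor a common upper bound. Hence, among idempotents
  other than the least one, having a meet different from the least is the same as being comparable,
  and it is transitive; its classes are chains that touch only at the bottom. If the group at the
  bottom has a second element, that element is a multiplier which excludes incomparable pairs
  altogether, and a single chain remains.\<close>

definition half_crossing :: "'a magma \<Rightarrow> 'a set \<Rightarrow> 'a set \<Rightarrow> 'a set \<Rightarrow> bool" where
  "half_crossing X E P Q \<longleftrightarrow> (\<forall>a\<in>P. \<exists>q\<in>Q. a \<star>\<^bsub>X\<^esub> q \<in> E) \<and>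
    (\<forall>a\<in>P. \<forall>a'\<in>P. \<exists>x\<in>carrier X. a \<star>\<^bsub>X\<^esub> x \<in> E \<and> a' \<star>\<^bsub>X\<^esub> x \<in> E)"

text \<open>If \<open>E\<close> separates \<open>\<A> * \<B>\<close> from \<open>\<B> * \<A>\<close>, then \<open>P \<in> \<A>\<close> collects the \<open>a\<close> with
  \<open>{b. a b \<in> E} \<in> \<B>\<close> and \<open>Q \<in> \<B>\<close> collects the \<open>b\<close> with \<open>{a. b a \<notin> E} \<in> \<A>\<close>. The two conditions
  say precisely that the sets required to lie in \<open>\<A>\<close>, respectively in \<open>\<B>\<close>, are linked.\<close>

definition crossing :: "'a magma \<Rightarrow> 'a set \<Rightarrow> 'a set \<Rightarrow> 'a set \<Rightarrow> bool" where
  "crossing X E P Q \<longleftrightarrow> P \<noteq> {} \<and> P \<subseteq> carrier X \<and> Q \<subseteq> carrier X \<and>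
    half_crossing X E P Q \<and> half_crossing X (- E) Q P"

definition crossed :: "'a magma \<Rightarrow> bool" where
  "crossed X \<longleftrightarrow> (\<exists>E P Q. crossing X E P Q)"

lemma crossing_flip: "crossing X E P Q \<Longrightarrow> crossing X (- E) Q P"
  unfolding crossing_def half_crossing_def by auto

section \<open>Maximal linked families and membership in their products\<close>

lemma upfamilies_mono:
  "\<lbrakk>\<F> \<in> upfamilies X; A \<in> \<F>; A \<subseteq> B; B \<subseteq> X\<rbrakk> \<Longrightarrow> B \<in> \<F>"
  unfolding upfamilies_def by blast

text \<open>Unless \<open>X - E\<close> belongs to \<F>, upward closure makes every member of \<F>
  meet \<open>E\<close>. Adjoining all supersets of \<open>E\<close> then keeps the family linked,
  so maximality already has \<open>E\<close> in it.\<close>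

lemma maximal_linked_Diff:
  assumes F: "\<F> \<in> maximal_linked X" and "E \<subseteq> X" "E \<notin> \<F>"
  shows "X - E \<in> \<F>"
proof (rule ccontr)
  assume n: "X - E \<notin> \<F>"
  have up: "\<F> \<in> upfamilies X" and lk: "linked \<F>"
    and mx: "\<And>\<G>. \<lbrakk>\<G> \<in> upfamilies X; linked \<G>; \<F> \<subseteq> \<G>\<rbrakk> \<Longrightarrow> \<F> = \<G>"
    using F unfolding maximal_linked_def by blast+
  have sub: "A \<subseteq> X" if "A \<in> \<F>" for A using up that unfolding upfamilies_def by blast
  have meet: "A \<inter> E \<noteq> {}" if "A \<in> \<F>" for A
    using upfamilies_mono[OF up that, of "X - E"] sub[OF that] n by blast
  obtain A where "A \<in> \<F>" using up unfolding upfamilies_def by blast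
  then have "E \<noteq> {}" using meet by blast
  let ?G = "\<F> \<union> {B. E \<subseteq> B \<and> B \<subseteq> X}"
  have "?G \<in> upfamilies X"
  proof -
    have "?G \<noteq> {}" "?G \<subseteq> Pow X - {{}}"
      using up \<open>E \<noteq> {}\<close> unfolding upfamilies_def by auto
    moreover have "B \<in> ?G" if "A \<in> ?G" "A \<subseteq> B" "B \<subseteq> X" for A B
      using that upfamilies_mono[OF up, of A B] by auto
    ultimately show ?thesis unfolding upfamilies_def by simp
  qed
  moreover have "linked ?G"
    unfolding linked_def
  proof (intro ballI)
    fix A B assume "A \<in> ?G" "B \<in> ?G"
    then show "A \<inter> B \<noteq> {}"
      using lk[unfolded linked_def, rule_format, of A B] meet[of A] meet[of B] \<open>E \<noteq> {}\<close> by auto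
  qed
  ultimately have "\<F> = ?G" using mx by blast
  then show False using assms by blast
qed

lemma maximal_linkedD:
  assumes "\<F> \<in> maximal_linked X"
  shows "\<F> \<in> upfamilies X" "\<And>A B. \<lbrakk>A \<in> \<F>; B \<in> \<F>\<rbrakk> \<Longrightarrow> A \<inter> B \<noteq> {}"
  using assms unfolding maximal_linked_def linked_def by blast+

text \<open>Zorn's lemma, started at the upfamily generated by \<G>. Linkedness involves two members
  at a time, so it passes to unions of chains.\<close>

lemma linked_extend_maximal:
  assumes sub: "\<G> \<subseteq> Pow X" and lk: "linked \<G>" and ne: "\<G> \<noteq> {}"
  shows "\<exists>\<F>\<in>maximal_linked X. \<G> \<subseteq> \<F>"
proof -
  let ?S = "{\<F>. \<F> \<in> upfamilies X \<and> linked \<F> \<and> \<G> \<subseteq> \<F>}"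
  have nonempty: "G \<noteq> {}" if "G \<in> \<G>" for G using lk that unfolding linked_def by blast
  have lk': "G \<inter> H \<noteq> {}" if "G \<in> \<G>" "H \<in> \<G>" for G H using lk that unfolding linked_def by blast
  have "generated X \<G> \<in> ?S"
  proof -
    have "generated X \<G> \<noteq> {}" "\<G> \<subseteq> generated X \<G>" using sub ne unfolding generated_def by auto
    moreover have "linked (generated X \<G>)"
      using lk' unfolding linked_def generated_def by simp blast
    moreover have "generated X \<G> \<subseteq> Pow X - {{}}"
      using nonempty unfolding generated_def by fastforce
    moreover have "\<forall>F\<in>generated X \<G>. \<forall>E. F \<subseteq> E \<and> E \<subseteq> X \<longrightarrow> E \<in> generated X \<G>"
      unfolding generated_def by blast
    ultimately show ?thesis unfolding upfamilies_def by blast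
  qed
  then have "?S \<noteq> {}" by blast
  moreover have "\<Union>C \<in> ?S" if "C \<noteq> {}" "subset.chain ?S C" for C
  proof -
    have C: "C \<subseteq> ?S" "\<And>A B. \<lbrakk>A \<in> C; B \<in> C\<rbrakk> \<Longrightarrow> A \<subseteq> B \<or> B \<subseteq> A"
      using that(2) by (auto simp: subset_chain_def)
    have "linked (\<Union>C)"
      unfolding linked_def
    proof (intro ballI)
      fix A B assume "A \<in> \<Union>C" "B \<in> \<Union>C"
      then obtain F G where "F \<in> C" "A \<in> F" "G \<in> C" "B \<in> G" by blast
      moreover from this C(2) have "F \<subseteq> G \<or> G \<subseteq> F" by blast
      moreover have "linked F" "linked G" using C(1) \<open>F \<in> C\<close> \<open>G \<in> C\<close> by auto
      ultimately show "A \<inter> B \<noteq> {}" unfolding linked_def by blast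
    qed
    moreover have "\<Union>C \<in> upfamilies X"
    proof -
      have up: "F \<in> upfamilies X" if "F \<in> C" for F using C(1) that by blast
      have "\<Union>C \<noteq> {}" using that(1) up unfolding upfamilies_def by fastforce
      moreover have "\<Union>C \<subseteq> Pow X - {{}}" using up unfolding upfamilies_def by blast
      moreover have "\<forall>F\<in>\<Union>C. \<forall>E. F \<subseteq> E \<and> E \<subseteq> X \<longrightarrow> E \<in> \<Union>C"
        using up upfamilies_mono by blast
      ultimately show ?thesis unfolding upfamilies_def by blast
    qed
    moreover have "\<G> \<subseteq> \<Union>C" using C(1) that(1) by blast
    ultimately show ?thesis by blast
  qed
  ultimately obtain M where M: "M \<in> ?S" and mx: "\<forall>Y\<in>?S. M \<subseteq> Y \<longrightarrow> Y = M"
    using subset_Zorn_nonempty[of ?S] by blast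
  have "M \<in> maximal_linked X"
    using M mx unfolding maximal_linked_def by (auto; blast)
  then show ?thesis using M by blast
qed

text \<open>For each \<open>a\<close> the largest admissible choice of \<open>B a\<close> is the set
  of all \<open>b\<close> with product in \<open>C\<close>. Upward closure of both factors lets any
  selection be enlarged to this one, so the quantifier over selections disappears.\<close>

lemma mem_upfamily_mult:
  assumes A: "\<A> \<in> upfamilies (carrier X)" and B: "\<B> \<in> upfamilies (carrier X)"
  shows "C \<in> upfamily_mult X \<A> \<B> \<longleftrightarrow>
    C \<subseteq> carrier X \<and> {a \<in> carrier X. {b \<in> carrier X. a \<star>\<^bsub>X\<^esub> b \<in> C} \<in> \<B>} \<in> \<A>"
    (is "_ \<longleftrightarrow> _ \<and> ?D \<in> _")
proof
  assume "C \<in> upfamily_mult X \<A> \<B>"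
  then obtain A0 f where f: "C \<subseteq> carrier X" "A0 \<in> \<A>" "f \<in> A0 \<rightarrow> \<B>"
      "(\<Union>a\<in>A0. {a \<star>\<^bsub>X\<^esub> b | b. b \<in> f a}) \<subseteq> C"
    unfolding upfamily_mult_def generated_def by auto
  have sub: "A0 \<subseteq> carrier X" using A f(2) unfolding upfamilies_def by blast
  have "a \<in> ?D" if a: "a \<in> A0" for a
  proof -
    have fa: "f a \<in> \<B>" using f(3) a by blast
    then have "f a \<subseteq> carrier X" using B unfolding upfamilies_def by blast
    moreover have "a \<star>\<^bsub>X\<^esub> b \<in> C" if "b \<in> f a" for b using f(4) a that by auto
    ultimately have "f a \<subseteq> {b \<in> carrier X. a \<star>\<^bsub>X\<^esub> b \<in> C}" by auto
    then have "{b \<in> carrier X. a \<star>\<^bsub>X\<^esub> b \<in> C} \<in> \<B>" using upfamilies_mono[OF B fa] by blast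
    then show ?thesis using a sub by blast
  qed
  then have "A0 \<subseteq> ?D" by blast
  then have "?D \<in> \<A>" by (rule upfamilies_mono[OF A f(2)]) blast
  then show "C \<subseteq> carrier X \<and> ?D \<in> \<A>" using f(1) by blast
next
  assume h: "C \<subseteq> carrier X \<and> ?D \<in> \<A>"
  let ?f = "\<lambda>a. {b \<in> carrier X. a \<star>\<^bsub>X\<^esub> b \<in> C}"
  define U where "U = (\<Union>a\<in>?D. {a \<star>\<^bsub>X\<^esub> b | b. b \<in> ?f a})"
  have "U \<subseteq> C" unfolding U_def by blast
  moreover have "U \<in>
      {\<Union>a\<in>A. {a \<star>\<^bsub>X\<^esub> b | b. b \<in> B a} | A B. A \<in> \<A> \<and> B \<in> A \<rightarrow> \<B>}"
    using h by (intro CollectI exI[of _ ?D] exI[of _ ?f] conjI) (auto simp: U_def)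
  ultimately have "\<exists>G\<in>{\<Union>a\<in>A. {a \<star>\<^bsub>X\<^esub> b | b. b \<in> B a} | A B. A \<in> \<A> \<and> B \<in> A \<rightarrow> \<B>}. G \<subseteq> C"
    by (rule bexI)
  with h show "C \<in> upfamily_mult X \<A> \<B>"
    unfolding upfamily_mult_def generated_def by (intro CollectI conjI) simp_all
qed

lemma linked_half_crossing:
  assumes "half_crossing X E P Q" "Q \<noteq> {}" "Q \<subseteq> carrier X"
  shows "linked (insert Q {{b \<in> carrier X. a \<star>\<^bsub>X\<^esub> b \<in> E} | a. a \<in> P})"
  unfolding linked_def
proof (intro ballI)
  fix A B
  assume "A \<in> insert Q {{b \<in> carrier X. a \<star>\<^bsub>X\<^esub> b \<in> E} | a. a \<in> P}"
    "B \<in> insert Q {{b \<in> carrier X. a \<star>\<^bsub>X\<^esub> b \<in> E} | a. a \<in> P}"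
  then show "A \<inter> B \<noteq> {}" using assms unfolding half_crossing_def by fast
qed

text \<open>The principal families at points form a copy of \<open>X\<close> in the superextension:
  the singleton of the product of \<open>x\<close> and \<open>y\<close> lies in the product of their
  families, and its membership in the reversed product identifies the two products in
  \<open>X\<close>.\<close>

lemma commutative_superextension_imp_commutative:
  assumes S: "carrier_semigroup X" and c: "commutative (superextension X)"
  shows "commutative X"
proof -
  interpret carrier_semigroup X by fact
  let ?p = "\<lambda>x. {A. A \<subseteq> carrier X \<and> x \<in> A}"
  have ml: "?p x \<in> maximal_linked (carrier X)" if x: "x \<in> carrier X" for x
  proof -
    have up: "?p x \<in> upfamilies (carrier X)" using x unfolding upfamilies_def by blast
    moreover have "linked (?p x)" unfolding linked_def by blast
    moreover have "?p x = \<G>"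
      if "\<G> \<in> upfamilies (carrier X)" "linked \<G>" "?p x \<subseteq> \<G>" for \<G>
    proof -
      have "{x} \<in> \<G>" using that(3) x by blast
      then have "x \<in> A" if "A \<in> \<G>" for A using \<open>linked \<G>\<close> that unfolding linked_def by blast
      then show ?thesis using that unfolding upfamilies_def by blast
    qed
    ultimately show ?thesis unfolding maximal_linked_def by blast
  qed
  show ?thesis
    unfolding commutative_def
  proof (intro ballI)
    fix x y assume x: "x \<in> carrier X" and y: "y \<in> carrier X"
    have "{x \<star>\<^bsub>X\<^esub> y} \<in> upfamily_mult X (?p x) (?p y)"
      using x y closed mem_upfamily_mult[OF ml[OF x, THEN maximal_linkedD(1)] ml[OF y, THEN maximal_linkedD(1)]]
      by auto
    also have "upfamily_mult X (?p x) (?p y) = upfamily_mult X (?p y) (?p x)"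
      using c ml x y unfolding commutative_def superextension_def by simp
    finally have "y \<star>\<^bsub>X\<^esub> x \<in> {x \<star>\<^bsub>X\<^esub> y}"
      using x y mem_upfamily_mult[OF ml[OF y, THEN maximal_linkedD(1)] ml[OF x, THEN maximal_linkedD(1)]]
      by auto
    then show "x \<star>\<^bsub>X\<^esub> y = y \<star>\<^bsub>X\<^esub> x" by simp
  qed
qed

theorem commutative_superextension_iff:
  assumes S: "carrier_semigroup X"
  shows "commutative (superextension X) \<longleftrightarrow> commutative X \<and> \<not> crossed X"
proof
  assume c: "commutative (superextension X)"
  have "\<not> crossed X"
  proof
    assume "crossed X"
    then obtain E P Q where *: "crossing X E P Q" unfolding crossed_def by blast
    then have P: "P \<noteq> {}" "P \<subseteq> carrier X" and Q: "Q \<noteq> {}" "Q \<subseteq> carrier X"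
      and h: "half_crossing X E P Q" "half_crossing X (- E) Q P"
      unfolding crossing_def half_crossing_def by blast+
    obtain \<B> where \<B>: "\<B> \<in> maximal_linked (carrier X)"
        "insert Q {{b \<in> carrier X. a \<star>\<^bsub>X\<^esub> b \<in> E} | a. a \<in> P} \<subseteq> \<B>"
      using linked_extend_maximal[OF _ linked_half_crossing[OF h(1) Q], of "carrier X"] Q by auto
    obtain \<A> where \<A>: "\<A> \<in> maximal_linked (carrier X)"
        "insert P {{b \<in> carrier X. a \<star>\<^bsub>X\<^esub> b \<in> - E} | a. a \<in> Q} \<subseteq> \<A>"
      using linked_extend_maximal[OF _ linked_half_crossing[OF h(2) P], of "carrier X"] P by auto
    note up = maximal_linkedD(1)[OF \<A>(1)] maximal_linkedD(1)[OF \<B>(1)]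
    interpret carrier_semigroup X by fact
    \<comment> \<open>Members of a product family are subsets of the carrier, whereas the
      \<open>E\<close> of a crossing is arbitrary.\<close>
    let ?C = "E \<inter> carrier X"
    have eq: "{b \<in> carrier X. a \<star>\<^bsub>X\<^esub> b \<in> ?C} = {b \<in> carrier X. a \<star>\<^bsub>X\<^esub> b \<in> E}" if "a \<in> carrier X" for a
      using closed that by auto
    have PD: "P \<subseteq> {a \<in> carrier X. {b \<in> carrier X. a \<star>\<^bsub>X\<^esub> b \<in> ?C} \<in> \<B>}"
    proof
      fix a assume a: "a \<in> P"
      then have "{b \<in> carrier X. a \<star>\<^bsub>X\<^esub> b \<in> E} \<in> \<B>" using \<B>(2) by blast
      then show "a \<in> {a \<in> carrier X. {b \<in> carrier X. a \<star>\<^bsub>X\<^esub> b \<in> ?C} \<in> \<B>}"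
        using eq[of a] P(2) a by auto
    qed
    have PA: "P \<in> \<A>" using \<A>(2) by blast
    have "{a \<in> carrier X. {b \<in> carrier X. a \<star>\<^bsub>X\<^esub> b \<in> ?C} \<in> \<B>} \<in> \<A>"
      by (rule upfamilies_mono[OF up(1) PA PD]) blast
    then have "?C \<in> upfamily_mult X \<A> \<B>" using mem_upfamily_mult[OF up] by blast
    also have "upfamily_mult X \<A> \<B> = upfamily_mult X \<B> \<A>"
      using c \<A>(1) \<B>(1) unfolding commutative_def superextension_def by simp
    finally have "{b \<in> carrier X. {a \<in> carrier X. b \<star>\<^bsub>X\<^esub> a \<in> ?C} \<in> \<A>} \<in> \<B>"
      using mem_upfamily_mult[OF up(2,1)] by blast
    moreover have "Q \<in> \<B>" using \<B>(2) by blast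
    ultimately obtain b where b: "b \<in> Q" "{a \<in> carrier X. b \<star>\<^bsub>X\<^esub> a \<in> ?C} \<in> \<A>"
      using maximal_linkedD(2)[OF \<B>(1)] by blast
    moreover have "{a \<in> carrier X. b \<star>\<^bsub>X\<^esub> a \<in> - E} \<in> \<A>" using \<A>(2) b(1) by blast
    ultimately show False using maximal_linkedD(2)[OF \<A>(1)] by blast
  qed
  then show "commutative X \<and> \<not> crossed X"
    using commutative_superextension_imp_commutative[OF S c] by blast
next
  assume a: "commutative X \<and> \<not> crossed X"
  have sub: "upfamily_mult X \<A> \<B> \<subseteq> upfamily_mult X \<B> \<A>"
    if A: "\<A> \<in> maximal_linked (carrier X)" and B: "\<B> \<in> maximal_linked (carrier X)" for \<A> \<B>
  proof
    fix C assume C: "C \<in> upfamily_mult X \<A> \<B>"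
    note up = maximal_linkedD(1)[OF A] maximal_linkedD(1)[OF B]
    let ?P = "{a \<in> carrier X. {b \<in> carrier X. a \<star>\<^bsub>X\<^esub> b \<in> C} \<in> \<B>}"
    let ?R = "{b \<in> carrier X. {a \<in> carrier X. b \<star>\<^bsub>X\<^esub> a \<in> C} \<in> \<A>}"
    let ?Q = "carrier X - ?R"
    have P: "?P \<in> \<A>" and CX: "C \<subseteq> carrier X" using C mem_upfamily_mult[OF up] by blast+
    show "C \<in> upfamily_mult X \<B> \<A>"
    proof (rule ccontr)
      assume "C \<notin> upfamily_mult X \<B> \<A>"
      then have "?R \<notin> \<B>" using mem_upfamily_mult[OF up(2,1)] CX by blast
      \<comment> \<open>\<open>?R\<close> decides whether \<open>C\<close> is in the reversed
        product. As it is not in \<B>, its complement is, and this complement is the second set of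
        the crossing.\<close>
      then have Q: "?Q \<in> \<B>" by (intro maximal_linked_Diff[OF B]) blast+
      have Q': "{a \<in> carrier X. b \<star>\<^bsub>X\<^esub> a \<in> - C} \<in> \<A>" if "b \<in> ?Q" for b
      proof -
        have "carrier X - {a \<in> carrier X. b \<star>\<^bsub>X\<^esub> a \<in> C} \<in> \<A>"
          by (intro maximal_linked_Diff[OF A]) (use that in blast)+
        also have "carrier X - {a \<in> carrier X. b \<star>\<^bsub>X\<^esub> a \<in> C} = {a \<in> carrier X. b \<star>\<^bsub>X\<^esub> a \<in> - C}" by blast
        finally show ?thesis .
      qed
      have P': "{b \<in> carrier X. a \<star>\<^bsub>X\<^esub> b \<in> C} \<in> \<B>" if "a \<in> ?P" for a using that by blast
      have hB: "half_crossing X C ?P ?Q"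
        unfolding half_crossing_def
      proof (intro conjI ballI)
        fix a assume "a \<in> ?P"
        from maximal_linkedD(2)[OF B P'[OF this] Q]
        show "\<exists>q\<in>?Q. a \<star>\<^bsub>X\<^esub> q \<in> C" by blast
      next
        fix a a' assume "a \<in> ?P" "a' \<in> ?P"
        from maximal_linkedD(2)[OF B this[THEN P']]
        show "\<exists>x\<in>carrier X. a \<star>\<^bsub>X\<^esub> x \<in> C \<and> a' \<star>\<^bsub>X\<^esub> x \<in> C" by blast
      qed
      have hA: "half_crossing X (- C) ?Q ?P"
        unfolding half_crossing_def
      proof (intro conjI ballI)
        fix a assume "a \<in> ?Q"
        from maximal_linkedD(2)[OF A Q'[OF this] P]
        show "\<exists>q\<in>?P. a \<star>\<^bsub>X\<^esub> q \<in> - C" by blast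
      next
        fix a a' assume "a \<in> ?Q" "a' \<in> ?Q"
        from maximal_linkedD(2)[OF A this[THEN Q']]
        show "\<exists>x\<in>carrier X. a \<star>\<^bsub>X\<^esub> x \<in> - C \<and> a' \<star>\<^bsub>X\<^esub> x \<in> - C" by blast
      qed
      have "?P \<noteq> {}" using maximal_linkedD(2)[OF A P P] by blast
      then have "crossing X C ?P ?Q" using hA hB unfolding crossing_def by (intro conjI) auto
      then show False using a unfolding crossed_def by blast
    qed
  qed
  then show "commutative (superextension X)"
    unfolding commutative_def superextension_def by (simp add: subset_antisym)
qed

section \<open>Semigroups without crossings\<close>

text \<open>\<open>E\<close> and \<open>E'\<close> are kept separate so that this applies both to
  the image of \<open>E\<close> and to the complement of that image.\<close>

lemma half_crossing_hom:
  assumes hom: "\<And>x y. \<lbrakk>x \<in> carrier X; y \<in> carrier X\<rbrakk> \<Longrightarrow> f (x \<star>\<^bsub>X\<^esub> y) = f x \<star>\<^bsub>Y\<^esub> f y"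
    and closed: "\<And>x y. \<lbrakk>x \<in> carrier X; y \<in> carrier X\<rbrakk> \<Longrightarrow> x \<star>\<^bsub>X\<^esub> y \<in> carrier X"
    and maps: "f ` carrier X \<subseteq> carrier Y" and sub: "P \<subseteq> carrier X" "Q \<subseteq> carrier X"
    and E: "\<And>w. w \<in> carrier X \<Longrightarrow> w \<in> E \<Longrightarrow> f w \<in> E'"
    and h: "half_crossing X E P Q"
  shows "half_crossing Y E' (f ` P) (f ` Q)"
proof -
  have 1: "f a \<star>\<^bsub>Y\<^esub> f q \<in> E'" if "a \<in> carrier X" "q \<in> carrier X" "a \<star>\<^bsub>X\<^esub> q \<in> E" for a q
    using E[OF closed[OF that(1,2)] that(3)] hom[OF that(1,2)] by simp
  show ?thesis
    unfolding half_crossing_def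
  proof (intro conjI ballI)
    fix a' assume "a' \<in> f ` P"
    then obtain a where a: "a \<in> P" "a' = f a" by blast
    then obtain q where "q \<in> Q" "a \<star>\<^bsub>X\<^esub> q \<in> E" using h unfolding half_crossing_def by blast
    then show "\<exists>q\<in>f ` Q. a' \<star>\<^bsub>Y\<^esub> q \<in> E'" using 1 a sub by blast
  next
    fix a' b' assume "a' \<in> f ` P" "b' \<in> f ` P"
    then obtain a b where a: "a \<in> P" "a' = f a" "b \<in> P" "b' = f b" by blast
    then obtain x where "x \<in> carrier X" "a \<star>\<^bsub>X\<^esub> x \<in> E" "b \<star>\<^bsub>X\<^esub> x \<in> E"
      using h unfolding half_crossing_def by blast
    then show "\<exists>x\<in>carrier Y. a' \<star>\<^bsub>Y\<^esub> x \<in> E' \<and> b' \<star>\<^bsub>Y\<^esub> x \<in> E'"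
      using 1 a sub maps by (intro bexI[of _ "f x"]) auto
  qed
qed

text \<open>A larger semigroup only offers more multipliers, so a crossing survives. Injectivity
  keeps the products outside \<open>E\<close> out of the image of \<open>E\<close>.\<close>

lemma crossed_embedding:
  assumes hom: "\<And>x y. \<lbrakk>x \<in> carrier X; y \<in> carrier X\<rbrakk> \<Longrightarrow> f (x \<star>\<^bsub>X\<^esub> y) = f x \<star>\<^bsub>Y\<^esub> f y"
    and closed: "\<And>x y. \<lbrakk>x \<in> carrier X; y \<in> carrier X\<rbrakk> \<Longrightarrow> x \<star>\<^bsub>X\<^esub> y \<in> carrier X"
    and maps: "f ` carrier X \<subseteq> carrier Y" and inj: "inj_on f (carrier X)"
    and "crossed X"
  shows "crossed Y"
proof -
  obtain E P Q where c: "crossing X E P Q" using \<open>crossed X\<close> unfolding crossed_def by blast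
  then have sub: "P \<noteq> {}" "P \<subseteq> carrier X" "Q \<subseteq> carrier X"
    and h: "half_crossing X E P Q" "half_crossing X (- E) Q P"
    unfolding crossing_def by simp_all
  let ?E = "f ` (E \<inter> carrier X)"
  have "half_crossing Y ?E (f ` P) (f ` Q)"
    by (rule half_crossing_hom[OF hom closed maps sub(2,3) _ h(1)]) auto
  moreover have "half_crossing Y (- ?E) (f ` Q) (f ` P)"
    by (rule half_crossing_hom[OF hom closed maps sub(3,2) _ h(2)]) (use inj in \<open>auto simp: inj_on_def\<close>)
  moreover have "f ` P \<noteq> {}" "f ` P \<subseteq> carrier Y" "f ` Q \<subseteq> carrier Y" using sub maps by auto
  ultimately have "crossing Y ?E (f ` P) (f ` Q)" unfolding crossing_def by (intro conjI)
  then show ?thesis unfolding crossed_def by (intro exI)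
qed

lemma isomorphic_trans:
  assumes "isomorphic X Y" "isomorphic Y Z"
  shows "isomorphic X Z"
proof -
  obtain f g where f: "bij_betw f (carrier X) (carrier Y)"
      "\<And>x y. \<lbrakk>x \<in> carrier X; y \<in> carrier X\<rbrakk> \<Longrightarrow> f (x \<star>\<^bsub>X\<^esub> y) = f x \<star>\<^bsub>Y\<^esub> f y"
    and g: "bij_betw g (carrier Y) (carrier Z)"
      "\<And>x y. \<lbrakk>x \<in> carrier Y; y \<in> carrier Y\<rbrakk> \<Longrightarrow> g (x \<star>\<^bsub>Y\<^esub> y) = g x \<star>\<^bsub>Z\<^esub> g y"
    using assms unfolding isomorphic_def by metis
  have "f x \<in> carrier Y" if "x \<in> carrier X" for x using f(1) that bij_betwE by blast
  then show ?thesis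
    unfolding isomorphic_def using bij_betw_trans[OF f(1) g(1)] f(2) g(2)
    by (intro exI[of _ "g \<circ> f"]) simp
qed

definition closed_magma :: "'a magma \<Rightarrow> bool" where
  "closed_magma X \<longleftrightarrow> (\<forall>x\<in>carrier X. \<forall>y\<in>carrier X. x \<star>\<^bsub>X\<^esub> y \<in> carrier X)"

text \<open>Undoing \<open>f\<close> on the product of \<open>?g x\<close> and \<open>?g y\<close>
  needs this product to lie in the carrier, which \<open>isomorphic\<close> alone does not
  guarantee.\<close>

lemma isomorphic_sym:
  assumes "isomorphic X Y" and "closed_magma X"
  shows "isomorphic Y X"
proof -
  obtain f where f: "bij_betw f (carrier X) (carrier Y)"
      "\<And>x y. \<lbrakk>x \<in> carrier X; y \<in> carrier X\<rbrakk> \<Longrightarrow> f (x \<star>\<^bsub>X\<^esub> y) = f x \<star>\<^bsub>Y\<^esub> f y"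
    using assms unfolding isomorphic_def by metis
  let ?g = "inv_into (carrier X) f"
  have g: "bij_betw ?g (carrier Y) (carrier X)" by (rule bij_betw_inv_into[OF f(1)])
  have "?g (x \<star>\<^bsub>Y\<^esub> y) = ?g x \<star>\<^bsub>X\<^esub> ?g y" if xy: "x \<in> carrier Y" "y \<in> carrier Y" for x y
  proof -
    have gx: "?g x \<in> carrier X" "?g y \<in> carrier X" using g xy bij_betwE by blast+
    then have "f (?g x \<star>\<^bsub>X\<^esub> ?g y) = x \<star>\<^bsub>Y\<^esub> y"
      using f xy by (simp add: bij_betw_inv_into_right)
    then show ?thesis
      using bij_betw_inv_into_left[OF f(1)] gx assms(2) unfolding closed_magma_def by metis
  qed
  then show ?thesis unfolding isomorphic_def using g by blast
qed

lemma isomorphic_crossed: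
  assumes "isomorphic X Y" "closed_magma X" "crossed X"
  shows "crossed Y"
proof -
  obtain f where f: "bij_betw f (carrier X) (carrier Y)"
      "\<And>x y. \<lbrakk>x \<in> carrier X; y \<in> carrier X\<rbrakk> \<Longrightarrow> f (x \<star>\<^bsub>X\<^esub> y) = f x \<star>\<^bsub>Y\<^esub> f y"
    using assms unfolding isomorphic_def by metis
  show ?thesis
    by (rule crossed_embedding[OF f(2) _ _ _ assms(3)])
      (use f(1) assms(2) in \<open>auto simp: bij_betw_def closed_magma_def\<close>)
qed

lemma isomorphic_commutative:
  assumes "isomorphic X Y" "closed_magma X" "commutative Y"
  shows "commutative X"
proof -
  obtain f where f: "bij_betw f (carrier X) (carrier Y)"
      "\<And>x y. \<lbrakk>x \<in> carrier X; y \<in> carrier X\<rbrakk> \<Longrightarrow> f (x \<star>\<^bsub>X\<^esub> y) = f x \<star>\<^bsub>Y\<^esub> f y"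
    using assms unfolding isomorphic_def by metis
  show ?thesis
    unfolding commutative_def
  proof (intro ballI)
    fix x y assume xy: "x \<in> carrier X" "y \<in> carrier X"
    have "f (x \<star>\<^bsub>X\<^esub> y) = f (y \<star>\<^bsub>X\<^esub> x)"
      using f(2) xy assms(3) bij_betwE[OF f(1)] unfolding commutative_def by auto
    then show "x \<star>\<^bsub>X\<^esub> y = y \<star>\<^bsub>X\<^esub> x"
      using f(1) xy assms(2) unfolding bij_betw_def inj_on_def closed_magma_def by blast
  qed
qed

section \<open>The models without crossings\<close>

text \<open>An additive model of the cyclic group: for a numeral \<open>n\<close> its carrier and
  product table can be computed by rewriting, unlike those of complex roots of unity.\<close>

definition residues_magma :: "nat \<Rightarrow> nat magma" where
  "residues_magma n = \<lparr>carrier = {..<n}, sop = (\<lambda>i j. (i + j) mod n)\<rparr>"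

lemma residues_magma_isomorphic_cyclic_group:
  assumes "n > 0"
  shows "isomorphic (residues_magma n) (cyclic_group n)"
proof -
  let ?f = "\<lambda>k. cis (2 * pi * real k / real n)"
  have per: "?f (k mod n) = ?f k" for k
  proof -
    have "real k = real (k mod n) + real n * real (k div n)"
      by (metis mod_mult_div_eq of_nat_add of_nat_mult)
    then have "2 * pi * real k / real n = 2 * pi * real (k mod n) / real n + 2 * pi * real (k div n)"
      using assms by (simp add: field_simps)
    then have "?f k = ?f (k mod n) * cis (2 * pi * real (k div n))" by (simp only: cis_mult)
    moreover have "cis (2 * pi * real (k div n)) = 1" by (rule cis_multiple_2pi) simp
    ultimately show ?thesis by (simp only: mult_1_right)
  qed
  have "?f ((i + j) mod n) = ?f i * ?f j" for i j
    unfolding per by (simp add: cis_mult add_divide_distrib distrib_left)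
  then show ?thesis
    unfolding isomorphic_def residues_magma_def cyclic_group_def
    using bij_betw_roots_unity[OF assms] by (intro exI[of _ ?f]) auto
qed

lemma carrier_cyclic_group_2: "carrier (cyclic_group 2) = {1, -1}"
  unfolding cyclic_group_def by (auto simp: power2_eq_1_iff)

lemma sop_cyclic_group: "sop (cyclic_group n) = (*)"
  unfolding cyclic_group_def by simp

lemma half_crossing_carrier:
  assumes "P \<subseteq> carrier X" "Q \<subseteq> carrier X" "half_crossing X E P Q"
  shows "\<forall>a\<in>carrier X. a \<in> P \<longrightarrow> (\<exists>q\<in>carrier X. q \<in> Q \<and> a \<star>\<^bsub>X\<^esub> q \<in> E)"
    "\<forall>a\<in>carrier X. \<forall>a'\<in>carrier X. a \<in> P \<and> a' \<in> P \<longrightarrow>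
      (\<exists>x\<in>carrier X. a \<star>\<^bsub>X\<^esub> x \<in> E \<and> a' \<star>\<^bsub>X\<^esub> x \<in> E)"
  using assms unfolding half_crossing_def by blast+

text \<open>With all quantifiers bounded by the carrier, a finite carrier and its product table turn
  these conditions into a propositional formula in the memberships in \<open>E\<close>,
  \<open>P\<close> and \<open>Q\<close>. The finite cases below refute that formula.\<close>

lemma crossing_carrier:
  assumes "crossing X E P Q"
  shows "\<exists>a\<in>carrier X. a \<in> P"
    "\<forall>a\<in>carrier X. a \<in> P \<longrightarrow> (\<exists>q\<in>carrier X. q \<in> Q \<and> a \<star>\<^bsub>X\<^esub> q \<in> E)"
    "\<forall>a\<in>carrier X. \<forall>a'\<in>carrier X. a \<in> P \<and> a' \<in> P \<longrightarrow>
      (\<exists>x\<in>carrier X. a \<star>\<^bsub>X\<^esub> x \<in> E \<and> a' \<star>\<^bsub>X\<^esub> x \<in> E)"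
    "\<forall>a\<in>carrier X. a \<in> Q \<longrightarrow> (\<exists>q\<in>carrier X. q \<in> P \<and> a \<star>\<^bsub>X\<^esub> q \<notin> E)"
    "\<forall>a\<in>carrier X. \<forall>a'\<in>carrier X. a \<in> Q \<and> a' \<in> Q \<longrightarrow>
      (\<exists>x\<in>carrier X. a \<star>\<^bsub>X\<^esub> x \<notin> E \<and> a' \<star>\<^bsub>X\<^esub> x \<notin> E)"
proof -
  have sub: "P \<noteq> {}" "P \<subseteq> carrier X" "Q \<subseteq> carrier X"
    and h: "half_crossing X E P Q" "half_crossing X (- E) Q P"
    using assms unfolding crossing_def by simp_all
  show "\<exists>a\<in>carrier X. a \<in> P" using sub by blast
qed (use assms half_crossing_carrier[of P X Q E] half_crossing_carrier[of Q X P "- E"] in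
  \<open>simp_all add: crossing_def\<close>)

lemma carrier_residues_magma_3: "carrier (residues_magma 3) = {0, 1, 2}"
  and carrier_residues_magma_4: "carrier (residues_magma 4) = {0, 1, 2, 3}"
  unfolding residues_magma_def by auto

lemma sop_residues_magma: "i \<star>\<^bsub>residues_magma n\<^esub> j = (i + j) mod n"
  unfolding residues_magma_def by simp

lemma not_crossed_residues_3: "\<not> crossed (residues_magma 3)" (is "\<not> crossed ?X")
proof
  assume "crossed ?X"
  then obtain E P Q where c: "crossing ?X E P Q" unfolding crossed_def by blast
  have m: "0 \<star>\<^bsub>?X\<^esub> 0 = 0" "0 \<star>\<^bsub>?X\<^esub> 1 = 1" "0 \<star>\<^bsub>?X\<^esub> 2 = 2" "1 \<star>\<^bsub>?X\<^esub> 0 = 1" "1 \<star>\<^bsub>?X\<^esub> 1 = 2" "1 \<star>\<^bsub>?X\<^esub> 2 = 0" "2 \<star>\<^bsub>?X\<^esub> 0 = 2" "2 \<star>\<^bsub>?X\<^esub> 1 = 0" "2 \<star>\<^bsub>?X\<^esub> 2 = 1"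
    by (simp_all add: sop_residues_magma)
  show False
    using crossing_carrier[OF c] unfolding carrier_residues_magma_3 ball_simps bex_simps m
    by argo
qed

lemma not_crossed_residues_4: "\<not> crossed (residues_magma 4)" (is "\<not> crossed ?X")
proof
  assume "crossed ?X"
  then obtain E P Q where c: "crossing ?X E P Q" unfolding crossed_def by blast
  have m: "0 \<star>\<^bsub>?X\<^esub> 0 = 0" "0 \<star>\<^bsub>?X\<^esub> 1 = 1" "0 \<star>\<^bsub>?X\<^esub> 2 = 2" "0 \<star>\<^bsub>?X\<^esub> 3 = 3" "1 \<star>\<^bsub>?X\<^esub> 0 = 1" "1 \<star>\<^bsub>?X\<^esub> 1 = 2" "1 \<star>\<^bsub>?X\<^esub> 2 = 3" "1 \<star>\<^bsub>?X\<^esub> 3 = 0" "2 \<star>\<^bsub>?X\<^esub> 0 = 2" "2 \<star>\<^bsub>?X\<^esub> 1 = 3" "2 \<star>\<^bsub>?X\<^esub> 2 = 0" "2 \<star>\<^bsub>?X\<^esub> 3 = 1" "3 \<star>\<^bsub>?X\<^esub> 0 = 3" "3 \<star>\<^bsub>?X\<^esub> 1 = 0" "3 \<star>\<^bsub>?X\<^esub> 2 = 1" "3 \<star>\<^bsub>?X\<^esub> 3 = 2"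
    by (simp_all add: sop_residues_magma)
  show False
    using crossing_carrier[OF c] unfolding carrier_residues_magma_4 ball_simps bex_simps m
    by argo
qed

lemma not_crossed_klein: "\<not> crossed (direct_product (cyclic_group 2) (cyclic_group 2))" (is "\<not> crossed ?X")
proof
  assume "crossed ?X"
  then obtain E P Q where c: "crossing ?X E P Q" unfolding crossed_def by blast
  have X: "carrier ?X = {(1,1),(1,-1),(-1,1),(-1,-1)}"
    by (auto simp: direct_product_def carrier_cyclic_group_2)
  have m: "(a,b) \<star>\<^bsub>?X\<^esub> (c,d) = (a*c,b*d)" for a b c d
    by (simp add: direct_product_def sop_cyclic_group)
  show False
    using crossing_carrier[OF c] unfolding X by (simp add: m) argo
qed

lemma not_crossed_C2_times_L2: "\<not> crossed (direct_product (cyclic_group 2) (linear_semilattice 2))" (is "\<not> crossed ?X")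
proof
  assume "crossed ?X"
  then obtain E P Q where c: "crossing ?X E P Q" unfolding crossed_def by blast
  have X: "carrier ?X = {(1,0),(1,1),(-1,0),(-1,1)}"
    by (auto simp: direct_product_def carrier_cyclic_group_2 linear_semilattice_def)
  have m: "(a,b) \<star>\<^bsub>?X\<^esub> (c,d) = (a*c,min b d)" for a b c d
    by (simp add: direct_product_def sop_cyclic_group linear_semilattice_def)
  show False
    using crossing_carrier[OF c] unfolding X by (simp add: m) argo
qed

lemma sop_linear_semilattice: "sop (linear_semilattice n) = min"
  unfolding linear_semilattice_def by simp

lemma not_crossed_L1_union_C2: "\<not> crossed (ordered_union (linear_semilattice 1) (cyclic_group 2))" (is "\<not> crossed ?X")
proof
  assume "crossed ?X"
  then obtain E P Q where c: "crossing ?X E P Q" unfolding crossed_def by blast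
  have X: "carrier ?X = {Inl 0, Inr 1, Inr (-1)}"
    by (auto simp: ordered_union_def carrier_cyclic_group_2 linear_semilattice_def)
  have m: "sop ?X = ordered_union_op (linear_semilattice 1) (cyclic_group 2)"
    by (simp add: ordered_union_def)
  show False
    using crossing_carrier[OF c] unfolding X m
    by (simp add: sop_cyclic_group sop_linear_semilattice) argo
qed

text \<open>The semigroup \<open>C\<^sub>2 \<squnion> L\<^sub>n\<close>, with kernel \<open>{z, v}\<close> in rank zero.\<close>

locale ranked_chain =
  fixes X :: "'a magma" (structure) and \<rho> :: "'a \<Rightarrow> nat" and z v :: 'a
  assumes below: "\<lbrakk>x \<in> carrier X; y \<in> carrier X; \<rho> x < \<rho> y\<rbrakk> \<Longrightarrow> x \<star> y = x"
    and above: "\<lbrakk>x \<in> carrier X; y \<in> carrier X; \<rho> x < \<rho> y\<rbrakk> \<Longrightarrow> y \<star> x = x"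
    and level: "\<lbrakk>x \<in> carrier X; y \<in> carrier X; \<rho> x = \<rho> y; \<rho> y > 0\<rbrakk> \<Longrightarrow> x = y"
    and idem: "\<lbrakk>x \<in> carrier X; \<rho> x > 0\<rbrakk> \<Longrightarrow> x \<star> x = x"
    and kernel: "x \<in> carrier X \<Longrightarrow> \<rho> x = 0 \<longleftrightarrow> x \<in> {z, v}"
    and z: "z \<in> carrier X" and v: "v \<in> carrier X"
    and mult: "z \<star> z = z" "z \<star> v = v" "v \<star> z = v" "v \<star> v = z"
    and finite: "finite (carrier X)"
begin

lemma rank_kernel: "\<rho> z = 0" "\<rho> v = 0"
  using kernel z v by blast+

lemma kernel_mult:
  assumes "x \<in> carrier X" "x \<notin> {z, v}" "y \<in> {z, v}"
  shows "x \<star> y = y" "y \<star> x = y"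
proof -
  have "y \<in> carrier X" "\<rho> y = 0" using assms(3) z v rank_kernel by blast+
  moreover have "\<rho> x > 0" using kernel assms(1,2) by blast
  ultimately show "x \<star> y = y" "y \<star> x = y" using above[of y x] below[of y x] assms(1) by simp_all
qed

lemma top_mult: "\<lbrakk>x \<in> carrier X; y \<in> carrier X; \<rho> x > 0; \<rho> y \<le> \<rho> x\<rbrakk> \<Longrightarrow> x \<star> y = y"
  using above[of y x] level[of x y] idem[of x] by (metis le_neq_implies_less)

text \<open>Some \<open>p\<close> in \<open>P\<close> must move \<open>q\<close> out of
  \<open>E\<close>, and only \<open>v\<close> moves a kernel element at all. So \<open>E\<close>
  contains \<open>q\<close> but not the product of \<open>q\<close> and \<open>v\<close>. Since
  \<open>v\<close> is then in \<open>P\<close>, it has a partner \<open>r\<close> in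
  \<open>Q\<close>, and \<open>q\<close> and \<open>r\<close> cannot have a common multiplier into
  the complement of \<open>E\<close>.\<close>

lemma not_crossing_kernel:
  assumes c: "crossing X E P Q" and q: "q \<in> Q" "q \<in> E" "\<rho> q = 0"
  shows False
proof -
  note cc = crossing_carrier[OF c]
  have Q: "Q \<subseteq> carrier X" using c unfolding crossing_def by simp
  have qX: "q \<in> carrier X" using q Q by blast
  then have qk: "q \<in> {z, v}" using kernel q by blast
  obtain p where p: "p \<in> carrier X" "p \<in> P" "q \<star> p \<notin> E" using cc(4) q qX by blast
  have "\<rho> p = 0" using below[of q p] qX p q by fastforce
  then have pk: "p \<in> {z, v}" using kernel p by blast
  have pv: "p = v" using pk qk q p by (auto simp: mult)
  obtain r where r: "r \<in> carrier X" "r \<in> Q" "v \<star> r \<in> E" using cc(2) v p pv by blast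
  have vr: "r \<notin> {z, v} \<Longrightarrow> v \<star> r = v" using kernel_mult(2)[of r v] r by blast
  consider "q = v" | "q = z" using qk by blast
  then show False
  proof cases
    case 1
    obtain x where x: "x \<in> carrier X" "v \<star> x \<notin> E" "r \<star> x \<notin> E" using cc(5) 1 q r v by blast
    have "v \<star> x = v" if "x \<notin> {z, v}" using kernel_mult(2)[of x v] that x by blast
    then have "x = v" using x 1 q by (cases "x = z"; cases "x = v") (auto simp: mult)
    then show False using x r 1 q pv p kernel_mult(1)[of r v] by (cases "r = z"; cases "r = v") (auto simp: mult)
  next
    case 2
    have "r = v" using r 2 q pv p vr by (cases "r = z"; cases "r = v") (auto simp: mult)
    then obtain x where x: "x \<in> carrier X" "v \<star> x \<notin> E" "z \<star> x \<notin> E" using cc(5) 2 q r v z by blast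
    have "z \<star> x = z" if "x \<notin> {z, v}" using kernel_mult(2)[of x z] that x by blast
    then show False using x 2 q by (cases "x = z"; cases "x = v") (auto simp: mult)
  qed
qed

text \<open>If \<open>q \<in> Q \<inter> E\<close> has positive rank, then any \<open>p \<in> P\<close> with \<open>q p \<notin> E\<close> lies strictly below \<open>q\<close>
  and outside \<open>E\<close>; after exchanging the roles of \<open>P\<close> and \<open>Q\<close> the argument repeats.\<close>

lemma not_crossing_descent:
  assumes "crossing X E P Q" "q \<in> Q" "q \<in> E"
  shows False
  using assms
proof (induction "\<rho> q" arbitrary: E P Q q rule: less_induct)
  case less
  have q: "q \<in> carrier X" using less.prems unfolding crossing_def by blast
  show ?case
  proof (cases "\<rho> q = 0")
    case True
    then show ?thesis using not_crossing_kernel less.prems by blast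
  next
    case False
    obtain p where p: "p \<in> carrier X" "p \<in> P" "q \<star> p \<notin> E"
      using crossing_carrier(4)[OF less.prems(1)] less.prems q by blast
    have "\<rho> p < \<rho> q"
    proof (rule ccontr)
      assume "\<not> \<rho> p < \<rho> q"
      then have "q \<star> p = q" using below[of q p] level[of p q] idem[of q] p q False
        by (cases "\<rho> p = \<rho> q") auto
      then show False using p less.prems by simp
    qed
    moreover from this have "p \<notin> E" using above[of p q] p q by auto
    ultimately show ?thesis
      using less.hyps[OF _ crossing_flip[OF less.prems(1)] p(2)] by simp
  qed
qed

text \<open>In positive rank \<open>m\<close> acts as an identity on \<open>Q\<close>, so the
  partner of \<open>m\<close> in \<open>Q\<close> lies in \<open>E\<close> itself and the descent
  applies. In rank zero the partners force \<open>m\<close> and \<open>p\<close> to be the two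
  kernel elements, and a common multiplier would put the whole kernel into \<open>E\<close>.\<close>

lemma not_crossing_top:
  assumes c: "crossing X E P Q" and m: "m \<in> P" "\<And>x. x \<in> P \<union> Q \<Longrightarrow> \<rho> x \<le> \<rho> m"
  shows False
proof (cases "\<rho> m = 0")
  case False
  have mX: "m \<in> carrier X" using c m unfolding crossing_def by blast
  then obtain q where "q \<in> carrier X" "q \<in> Q" "m \<star> q \<in> E"
    using crossing_carrier(2)[OF c] m by blast
  moreover from this have "m \<star> q = q" using top_mult mX m(2) False by auto
  ultimately show False using not_crossing_descent[OF c] by simp
next
  case True
  note cc = crossing_carrier[OF c]
  have sub: "P \<subseteq> {z, v}" "Q \<subseteq> {z, v}"
    using True m(2) kernel c unfolding crossing_def by auto
  have mX: "m \<in> carrier X" using c m unfolding crossing_def by blast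
  obtain q where q: "q \<in> carrier X" "q \<in> Q" "m \<star> q \<in> E" using cc(2) m mX by blast
  obtain p where p: "p \<in> carrier X" "p \<in> P" "q \<star> p \<notin> E" using cc(4) q by blast
  obtain x where x: "x \<in> carrier X" "m \<star> x \<in> E" "p \<star> x \<in> E" using cc(3) m mX p by blast
  have "m \<star> x = m \<and> p \<star> x = p" if "x \<notin> {z, v}"
    using kernel_mult(2)[of x] that x(1) p(2) m(1) sub(1) by blast
  moreover have "m = z \<or> m = v" "p = z \<or> p = v" "q = z \<or> q = v" using m(1) p(2) q(2) sub by blast+
  ultimately show False
    using x(2,3) p(3) q(3) by (cases "x = z"; cases "x = v") (auto simp: mult)
qed

lemma not_crossed: "\<not> crossed X"
proof
  assume "crossed X"
  then obtain E P Q where c: "crossing X E P Q" unfolding crossed_def by blast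
  then have sub: "P \<union> Q \<subseteq> carrier X" "P \<union> Q \<noteq> {}" unfolding crossing_def by simp_all
  then have fin: "finite (\<rho> ` (P \<union> Q))" "\<rho> ` (P \<union> Q) \<noteq> {}" using finite_subset[OF sub(1) finite] by simp_all
  obtain m where m: "m \<in> P \<union> Q" "\<rho> m = Max (\<rho> ` (P \<union> Q))"
    using Max_in[OF fin] by (elim imageE) simp
  have max: "\<rho> x \<le> \<rho> m" if "x \<in> P \<union> Q" for x
    unfolding m(2) using fin(1) that by (intro Max_ge imageI)
  from m(1) consider "m \<in> P" | "m \<in> Q" by blast
  then show False
  proof cases
    case 1
    then show False by (rule not_crossing_top[OF c _ max])
  next
    case 2
    then show False using max by (intro not_crossing_top[OF crossing_flip[OF c]]) blast+
  qed
qed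

end

lemma not_crossed_C2_union_Ln: "\<not> crossed (ordered_union (cyclic_group 2) (linear_semilattice n))"
proof -
  \<comment> \<open>\<open>Suc\<close> shifts the chain up by one, leaving rank zero to the
    two-element group.\<close>
  interpret ranked_chain "ordered_union (cyclic_group 2) (linear_semilattice n)"
    "case_sum (\<lambda>_. 0) Suc" "Inl 1" "Inl (-1)"
    by unfold_locales
      (auto simp: ordered_union_def carrier_cyclic_group_2 sop_cyclic_group linear_semilattice_def)
  show ?thesis by (rule not_crossed)
qed

lemma not_crossed_Ln: "\<not> crossed (linear_semilattice n)"
proof
  assume "crossed (linear_semilattice n)"
  then have "crossed (ordered_union (cyclic_group 2) (linear_semilattice n))"
    by (rule crossed_embedding[where f = Inr, rotated -1])
      (auto simp: ordered_union_def linear_semilattice_def)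
  then show False using not_crossed_C2_union_Ln by blast
qed

lemma not_crossed_C2: "\<not> crossed (cyclic_group 2)"
proof
  assume "crossed (cyclic_group 2)"
  \<comment> \<open>\<open>linear_semilattice 0\<close> is empty, so this union is just a copy of
    the group.\<close>
  then have "crossed (ordered_union (cyclic_group 2) (linear_semilattice 0))"
    by (rule crossed_embedding[where f = Inl, rotated -1])
      (auto simp: ordered_union_def carrier_cyclic_group_2 sop_cyclic_group)
  then show False using not_crossed_C2_union_Ln by blast
qed

lemma closed_residues_magma: "n > 0 \<Longrightarrow> closed_magma (residues_magma n)"
  unfolding closed_magma_def residues_magma_def by simp

lemma closed_cyclic_group: "closed_magma (cyclic_group n)"
  unfolding closed_magma_def cyclic_group_def by (simp add: power_mult_distrib)

lemma not_crossed_C3: "\<not> crossed (cyclic_group 3)"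
  and not_crossed_C4: "\<not> crossed (cyclic_group 4)"
  using not_crossed_residues_3 not_crossed_residues_4
    isomorphic_crossed[OF isomorphic_sym[OF residues_magma_isomorphic_cyclic_group closed_residues_magma] closed_cyclic_group]
  by (metis zero_less_numeral)+

lemma commutative_cyclic_group: "commutative (cyclic_group n)"
  unfolding commutative_def cyclic_group_def by (simp add: mult.commute)

lemma commutative_linear_semilattice: "commutative (linear_semilattice n)"
  unfolding commutative_def linear_semilattice_def by (simp add: min.commute)

lemma commutative_direct_product:
  "\<lbrakk>commutative X; commutative Y\<rbrakk> \<Longrightarrow> commutative (direct_product X Y)"
  unfolding commutative_def direct_product_def by auto

lemma commutative_ordered_union:
  "\<lbrakk>commutative X; commutative Y\<rbrakk> \<Longrightarrow> commutative (ordered_union X Y)"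
  unfolding commutative_def ordered_union_def by auto

lemma bouquet_commutative_not_crossed:
  assumes b: "zero_bouquet X I S"
    and c: "\<And>i. i \<in> I \<Longrightarrow> commutative (X\<lparr>carrier := S i\<rparr>)"
    and n: "\<And>i. i \<in> I \<Longrightarrow> \<not> crossed (X\<lparr>carrier := S i\<rparr>)"
  shows "commutative X" "\<not> crossed X"
proof -
  obtain z where z: "is_zero X z"
    and d: "\<forall>i\<in>I. \<forall>j\<in>I. i \<noteq> j \<longrightarrow>
      S i \<inter> S j = {z} \<and> {x \<star>\<^bsub>X\<^esub> y | x y. x \<in> S i \<and> y \<in> S j} = {z}"
    using b unfolding zero_bouquet_def by (elim conjE exE)
  have X: "carrier X = (\<Union>i\<in>I. S i)" and sub: "\<And>i. i \<in> I \<Longrightarrow> subsemigroup (S i) X"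
    using b unfolding zero_bouquet_def by simp_all
  have meet: "S i \<inter> S j = {z}" if "i \<in> I" "j \<in> I" "i \<noteq> j" for i j
    using d that by simp
  have cross: "x \<star>\<^bsub>X\<^esub> y = z" if "i \<in> I" "j \<in> I" "i \<noteq> j" "x \<in> S i" "y \<in> S j" for i j x y
  proof -
    have "{x \<star>\<^bsub>X\<^esub> y | x y. x \<in> S i \<and> y \<in> S j} = {z}" using d that by simp
    moreover have "x \<star>\<^bsub>X\<^esub> y \<in> {x \<star>\<^bsub>X\<^esub> y | x y. x \<in> S i \<and> y \<in> S j}" using that(4,5) by blast
    ultimately show ?thesis by simp
  qed
  show com: "commutative X"
    unfolding commutative_def
  proof (intro ballI)
    fix x y assume "x \<in> carrier X" "y \<in> carrier X"
    then obtain i j where ij: "i \<in> I" "j \<in> I" "x \<in> S i" "y \<in> S j" unfolding X by blast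
    show "x \<star>\<^bsub>X\<^esub> y = y \<star>\<^bsub>X\<^esub> x"
    proof (cases "i = j")
      case True
      then show ?thesis using c[OF ij(1)] ij unfolding commutative_def by simp
    next
      case False
      then show ?thesis using cross[of i j x y] cross[of j i y x] ij by simp
    qed
  qed
  have no: False if c: "crossing X E P Q" and zE: "z \<notin> E" for E P Q
  proof -
    note cc = crossing_carrier[OF c]
    have PX: "P \<subseteq> carrier X" and QX: "Q \<subseteq> carrier X" and "P \<noteq> {}" using c unfolding crossing_def by simp_all
    then obtain a i where a: "a \<in> P" "i \<in> I" "a \<in> S i" unfolding X by blast
    \<comment> \<open>Products across different members equal \<open>z\<close>, which is outside
      \<open>E\<close>; a product in \<open>E\<close> therefore keeps both factors in one
      member.\<close>
    have comp: "x \<in> S i" if x: "x \<in> carrier X" and y: "y \<in> S i" and "x \<star>\<^bsub>X\<^esub> y \<in> E" for x y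
    proof -
      obtain j where "j \<in> I" "x \<in> S j" using x unfolding X by blast
      then show ?thesis using cross[of j i x y] a y that zE by (cases "j = i") auto
    qed
    have comp': "x \<in> S i" if x: "x \<in> carrier X" and y: "y \<in> S i" and "y \<star>\<^bsub>X\<^esub> x \<in> E" for x y
      using comp[OF x y] that com sub[OF a(2)] unfolding commutative_def subsemigroup_def by auto
    have pair: "\<exists>x\<in>S i. b \<star>\<^bsub>X\<^esub> x \<in> E \<and> b' \<star>\<^bsub>X\<^esub> x \<in> E" if "b \<in> P" "b' \<in> P" "b \<in> S i" for b b'
      using cc(3) that PX comp' by blast
    have PS: "P \<subseteq> S i"
    proof
      fix b assume "b \<in> P"
      then show "b \<in> S i" using pair[OF a(1) _ a(3)] comp PX by blast
    qed
    let ?Y = "X\<lparr>carrier := S i\<rparr>"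
    have zS: "z \<in> S i"
    proof -
      obtain j where j: "j \<in> I" "z \<in> S j" using z unfolding is_zero_def X by blast
      then show ?thesis using meet[of i j] a(2) by (cases "j = i") auto
    qed
    \<comment> \<open>The partners in \<open>Q\<close> of elements of \<open>P\<close> lie in the
      same member as \<open>P\<close>, so cutting \<open>Q\<close> down to \<open>S i\<close> loses
      none of them.\<close>
    have "half_crossing ?Y E P (Q \<inter> S i)"
      unfolding half_crossing_def
    proof (intro conjI ballI)
      fix b assume b: "b \<in> P"
      then obtain q where "q \<in> Q" "b \<star>\<^bsub>X\<^esub> q \<in> E" using cc(2) PX by blast
      then show "\<exists>q\<in>Q \<inter> S i. b \<star>\<^bsub>?Y\<^esub> q \<in> E" using comp'[of q b] QX b PS by auto
    next
      fix b b' assume "b \<in> P" "b' \<in> P"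
      then show "\<exists>x\<in>carrier ?Y. b \<star>\<^bsub>?Y\<^esub> x \<in> E \<and> b' \<star>\<^bsub>?Y\<^esub> x \<in> E"
        using pair PS by auto
    qed
    moreover have "half_crossing ?Y (- E) (Q \<inter> S i) P"
      unfolding half_crossing_def
    proof (intro conjI ballI)
      fix b assume b: "b \<in> Q \<inter> S i"
      then show "\<exists>q\<in>P. b \<star>\<^bsub>?Y\<^esub> q \<in> - E" using cc(4) QX by auto
    next
      fix b b' assume "b \<in> Q \<inter> S i" "b' \<in> Q \<inter> S i"
      then have "b \<star>\<^bsub>X\<^esub> z = z" "b' \<star>\<^bsub>X\<^esub> z = z" using z QX unfolding is_zero_def by auto
      \<comment> \<open>For the complement of \<open>E\<close> the zero is a common multiplier of
        everything.\<close>
      then show "\<exists>x\<in>carrier ?Y. b \<star>\<^bsub>?Y\<^esub> x \<in> - E \<and> b' \<star>\<^bsub>?Y\<^esub> x \<in> - E"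
        using zS zE by (intro bexI[of _ z]) auto
    qed
    ultimately have "crossing ?Y E P (Q \<inter> S i)"
      using PS a unfolding crossing_def by auto
    then show False using n[OF a(2)] unfolding crossed_def by blast
  qed
  show "\<not> crossed X"
  proof
    assume "crossed X"
    then obtain E P Q where c: "crossing X E P Q" unfolding crossed_def by blast
    show False
      using no[OF c] no[OF crossing_flip[OF c]] by (cases "z \<in> E") auto
  qed
qed

section \<open>The semilattice of groups\<close>

locale uncrossed_semigroup = carrier_semigroup +
  assumes commute: "\<lbrakk>x \<in> carrier X; y \<in> carrier X\<rbrakk> \<Longrightarrow> x \<star> y = y \<star> x"
    and regular: "x \<in> carrier X \<Longrightarrow> \<exists>y\<in>carrier X. x = (x \<star> y) \<star> x"
    and uncrossed: "\<not> crossed X"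
begin

lemma left_commute:
  "\<lbrakk>x \<in> carrier X; y \<in> carrier X; w \<in> carrier X\<rbrakk> \<Longrightarrow> x \<star> (y \<star> w) = y \<star> (x \<star> w)"
  using assoc commute by metis

text \<open>This excludes all finite configurations; it is the crossing with \<open>P = {p, p'}\<close> and \<open>Q = {q, q'}\<close>,
  where \<open>r\<close> and \<open>s\<close> are the common multipliers.\<close>

lemma no_square:
  assumes "p \<in> carrier X" "p' \<in> carrier X" "q \<in> carrier X" "q' \<in> carrier X" "r \<in> carrier X" "s \<in> carrier X"
    and "{p \<star> q, p' \<star> q', p \<star> r, p' \<star> r} \<inter> {p \<star> q', p' \<star> q, q \<star> s, q' \<star> s} = {}"
  shows False
proof -
  let ?E = "{p \<star> q, p' \<star> q', p \<star> r, p' \<star> r}"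
  have qp: "q \<star> p' = p' \<star> q" "q' \<star> p = p \<star> q'" using assms commute by blast+
  have "half_crossing X ?E {p, p'} {q, q'}"
    unfolding half_crossing_def using assms(5) by simp blast
  moreover have "p \<star> q' \<notin> ?E" "p' \<star> q \<notin> ?E" "q \<star> s \<notin> ?E" "q' \<star> s \<notin> ?E"
    using assms(7) by blast+
  then have "half_crossing X (- ?E) {q, q'} {p, p'}"
    unfolding half_crossing_def
    by (intro conjI ballI bexI[OF _ assms(6)]) (auto simp: qp)
  ultimately have "crossing X ?E {p, p'} {q, q'}" using assms unfolding crossing_def by simp
  then show False using uncrossed unfolding crossed_def by blast
qed

definition idems :: "'a set" where
  "idems = {e \<in> carrier X. e \<star> e = e}"

text \<open>\<open>x\<close> lies in the maximal subgroup with identity \<open>e\<close>.\<close>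

definition in_group :: "'a \<Rightarrow> 'a \<Rightarrow> bool" where
  "in_group e x \<longleftrightarrow> e \<in> idems \<and> x \<in> carrier X \<and> x \<star> e = x \<and>
    (\<exists>y\<in>carrier X. y \<star> e = y \<and> x \<star> y = e)"

lemma idems: "e \<in> idems \<Longrightarrow> e \<in> carrier X" "e \<in> idems \<Longrightarrow> e \<star> e = e"
  unfolding idems_def by simp_all

lemma in_group_ex: assumes x: "x \<in> carrier X" shows "\<exists>e. in_group e x"
proof -
  obtain y where y: "y \<in> carrier X" "x = (x \<star> y) \<star> x" using regular[OF x] by blast
  let ?e = "x \<star> y"
  have e: "?e \<in> carrier X" "?e \<star> ?e = ?e"
    using y x closed assoc[of "x \<star> y" x y] by auto
  have "x \<star> ?e = x" using y x closed commute by metis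
  \<comment> \<open>The regularity witness \<open>y\<close> need not lie in the group of
    \<open>?e\<close>; multiplying it by \<open>?e\<close> gives the inverse that does.\<close>
  moreover have "x \<star> (y \<star> ?e) = ?e" using e x y assoc[of x y "x \<star> y"] by simp
  moreover have "(y \<star> ?e) \<star> ?e = y \<star> ?e" using e y assoc by simp
  ultimately have "in_group ?e x"
    unfolding in_group_def idems_def using e x y closed by (intro conjI bexI[of _ "y \<star> ?e"]) auto
  then show ?thesis by blast
qed

text \<open>Since \<open>x\<close> absorbs \<open>f\<close>, so does every multiple of
  \<open>x\<close>, in particular \<open>e\<close>. By symmetry \<open>f\<close> absorbs
  \<open>e\<close>, and commutativity identifies them.\<close>

lemma in_group_unique: assumes "in_group e x" "in_group f x" shows "e = f"
proof -
  have 1: "e \<star> f = e" if ef: "in_group e x" "in_group f x" for e f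
  proof -
    obtain y where y: "y \<in> carrier X" "x \<star> y = e" using ef unfolding in_group_def by blast
    have c: "e \<in> carrier X" "f \<in> carrier X" "x \<in> carrier X" "x \<star> f = x"
      using ef idems unfolding in_group_def by auto
    have "e \<star> f = (x \<star> y) \<star> f" using y by simp
    also have "\<dots> = (x \<star> f) \<star> y" using y c assoc[of x y f] assoc[of x f y] commute[of y f] by simp
    finally show ?thesis using y c by simp
  qed
  show ?thesis using 1[OF assms] 1[OF assms(2,1)] commute assms idems unfolding in_group_def by metis
qed

definition unit_of :: "'a \<Rightarrow> 'a" where
  "unit_of x = (THE e. in_group e x)"

lemma in_group_unit_of: "x \<in> carrier X \<Longrightarrow> in_group (unit_of x) x"
  unfolding unit_of_def using in_group_ex in_group_unique by (metis theI)

lemma unit_of_eq: "in_group e x \<Longrightarrow> unit_of x = e"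
  using in_group_unit_of in_group_unique unfolding in_group_def by blast

lemma unit_of_idem: "e \<in> idems \<Longrightarrow> unit_of e = e"
  by (rule unit_of_eq) (use idems in \<open>auto simp: in_group_def\<close>)

lemma unit_of_in_idems: "x \<in> carrier X \<Longrightarrow> unit_of x \<in> idems"
  using in_group_unit_of unfolding in_group_def by blast

lemma mult_unit_of:
  assumes "x \<in> carrier X" shows "x \<star> unit_of x = x" "unit_of x \<star> x = x"
  using in_group_unit_of[OF assms] idems commute unfolding in_group_def by auto

lemma swap:
  assumes "a \<in> carrier X" "b \<in> carrier X" "c \<in> carrier X" "d \<in> carrier X"
  shows "(a \<star> b) \<star> (c \<star> d) = (a \<star> c) \<star> (b \<star> d)"
  using assms by (simp add: assoc closed left_commute[of b c d])

lemma idems_mult: assumes "e \<in> idems" "f \<in> idems" shows "e \<star> f \<in> idems"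
proof -
  have c: "e \<in> carrier X" "f \<in> carrier X" using assms idems by auto
  have "(e \<star> f) \<star> (e \<star> f) = (e \<star> e) \<star> (f \<star> f)" using c by (intro swap)
  then show ?thesis using assms c closed unfolding idems_def by simp
qed

text \<open>Inverses multiply to an inverse of the product. Thus \<open>unit_of\<close> is a
  homomorphism onto the semilattice of idempotents, the Clifford decomposition. Below it also serves
  as an invariant: elements with different units are distinct.\<close>

lemma unit_of_mult:
  assumes x: "x \<in> carrier X" and y: "y \<in> carrier X"
  shows "unit_of (x \<star> y) = unit_of x \<star> unit_of y"
proof (rule unit_of_eq)
  let ?e = "unit_of x" and ?f = "unit_of y"
  have ef: "?e \<in> idems" "?f \<in> idems" using x y unit_of_in_idems by auto
  then have c: "?e \<in> carrier X" "?f \<in> carrier X" using idems by auto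
  obtain x' where x': "x' \<in> carrier X" "x' \<star> ?e = x'" "x \<star> x' = ?e"
    using in_group_unit_of[OF x] unfolding in_group_def by blast
  obtain y' where y': "y' \<in> carrier X" "y' \<star> ?f = y'" "y \<star> y' = ?f"
    using in_group_unit_of[OF y] unfolding in_group_def by blast
  have "(x \<star> y) \<star> (?e \<star> ?f) = x \<star> y" using swap[of x y ?e ?f] x y c mult_unit_of by simp
  moreover have "(x' \<star> y') \<star> (?e \<star> ?f) = x' \<star> y'" using swap[of x' y' ?e ?f] x' y' c by simp
  moreover have "(x \<star> y) \<star> (x' \<star> y') = ?e \<star> ?f" using swap[of x y x' y'] x' y' x y by simp
  ultimately show "in_group (?e \<star> ?f) (x \<star> y)"
    unfolding in_group_def using idems_mult[OF ef] x y x' y' closed by blast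
qed

lemma inverse_ex:
  assumes "x \<in> carrier X"
  obtains y where "y \<in> carrier X" "unit_of y = unit_of x" "x \<star> y = unit_of x"
proof -
  let ?e = "unit_of x"
  obtain y where y: "y \<in> carrier X" "y \<star> ?e = y" "x \<star> y = ?e"
    using in_group_unit_of[OF assms] unfolding in_group_def by blast
  have "in_group ?e y" unfolding in_group_def
    using y unit_of_in_idems[OF assms] assms commute[of y x] mult_unit_of[OF assms]
    by (intro conjI bexI[of _ x]) simp_all
  then show ?thesis using that y unit_of_eq by blast
qed

lemma cancel:
  assumes "a \<in> carrier X" "b \<in> carrier X" "c \<in> carrier X" "unit_of b = unit_of a" "unit_of c = unit_of a"
    and "a \<star> b = a \<star> c"
  shows "b = c"
proof -
  obtain y where y: "y \<in> carrier X" "a \<star> y = unit_of a" using inverse_ex[OF assms(1)] by blast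
  have "unit_of a \<star> b = y \<star> (a \<star> b)" "unit_of a \<star> c = y \<star> (a \<star> c)"
    using y assms assoc[of y a b] assoc[of y a c] commute[of y a] by simp_all
  then show ?thesis using assms mult_unit_of[OF assms(2)] mult_unit_of[OF assms(3)] by simp
qed

lemma cancel_unit:
  assumes "a \<in> carrier X" "b \<in> carrier X" "unit_of b = unit_of a" "a \<star> b = a"
  shows "b = unit_of a"
  using cancel[of a b "unit_of a"] assms mult_unit_of[of a] unit_of_in_idems[of a] unit_of_idem idems
  by auto

section \<open>Forbidden configurations of groups and idempotents\<close>

lemma absorb_trans: "\<lbrakk>x \<in> carrier X; y \<in> carrier X; w \<in> carrier X; x \<star> y = x; y \<star> w = y\<rbrakk> \<Longrightarrow> x \<star> w = x"
  using assoc by metis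

text \<open>In the lemmas below \<open>e \<star> f = e\<close> with \<open>e \<noteq> f\<close> says \<open>e < f\<close> in the semilattice of idempotents.\<close>

lemma big_group_no_idem_above:
  assumes e: "e \<in> idems" and f: "f \<in> idems" "e \<star> f = e" "e \<noteq> f"
    and a: "a \<in> carrier X" "unit_of a = e" "a \<noteq> e" and c: "c \<in> carrier X" "unit_of c = e" "c \<noteq> e" "c \<noteq> a"
  shows False
proof -
  have X: "e \<in> carrier X" "f \<in> carrier X" using e f idems by auto
  have m: "e \<star> a = a" "e \<star> c = c" "f \<star> f = f" "a \<star> e = a"
    using a c mult_unit_of[of a] mult_unit_of[of c] f idems by auto
  have af: "a \<star> f = a" using absorb_trans[of a e f] a X m f by blast
  have u: "unit_of (a \<star> a) = e" "unit_of (a \<star> c) = e" "unit_of f = f"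
    using unit_of_mult a c e idems unit_of_idem f by auto
  have n: "a \<star> a \<noteq> a" "a \<star> c \<noteq> a" using cancel_unit a c by metis+
  show False
    \<comment> \<open>Inside \<open>E\<close> are \<open>e\<close>, \<open>c\<close> and the
      products of \<open>a\<close> with \<open>a\<close> and \<open>c\<close>; outside are
      \<open>a\<close> and \<open>f\<close>.\<close>
    by (rule no_square[of e a f a c f]) (use X a c m af u n f e idems commute[of f a] in auto)
qed

text \<open>Here \<open>P = Q = {e, a}\<close>. The multiplier \<open>c\<close> stays in the group
  of \<open>e\<close> and avoids \<open>a\<close>, while the multiplier \<open>f\<close> drops into
  the group of \<open>f\<close>, away from \<open>E\<close>.\<close>

lemma big_group_no_idem_below:
  assumes e: "e \<in> idems" and f: "f \<in> idems" "f \<star> e = f" "e \<noteq> f"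
    and a: "a \<in> carrier X" "unit_of a = e" "a \<noteq> e" and c: "c \<in> carrier X" "unit_of c = e" "c \<noteq> e" "c \<noteq> a"
  shows False
proof -
  have X: "e \<in> carrier X" "f \<in> carrier X" using e f idems by auto
  have m: "e \<star> a = a" "e \<star> c = c" "e \<star> f = f" "a \<star> e = a" "e \<star> e = e"
    using a c mult_unit_of[of a] mult_unit_of[of c] f idems commute X e by auto
  have u: "unit_of (a \<star> a) = e" "unit_of (a \<star> c) = e" "unit_of f = f" "unit_of (a \<star> f) = f" "unit_of e = e"
    using unit_of_mult a c e idems unit_of_idem f m X by auto
  have n: "a \<star> a \<noteq> a" "a \<star> c \<noteq> a" using cancel_unit a c by metis+
  show False
    by (rule no_square[of e a e a c f]) (use X a c m u n f(3) in auto)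
qed

text \<open>Both \<open>f\<close> and \<open>g\<close> fix the kernel pointwise, so \<open>u\<close>
  and \<open>z\<close> are common multipliers with different values: \<open>f\<close>,
  \<open>g\<close>, \<open>u\<close> go into \<open>E\<close>, and the meet \<open>z\<close> stays
  out.\<close>

lemma kernel_group_chain:
  assumes z: "z \<in> idems" and u: "u \<in> carrier X" "unit_of u = z" "u \<noteq> z"
    and f: "f \<in> idems" and g: "g \<in> idems" and fg: "f \<star> g = z"
  shows "f = z \<or> g = z"
proof (rule ccontr)
  assume n: "\<not> (f = z \<or> g = z)"
  have X: "z \<in> carrier X" "f \<in> carrier X" "g \<in> carrier X" using z f g idems by auto
  have m: "f \<star> f = f" "g \<star> g = g" "u \<star> z = u" using f g idems mult_unit_of[of u] u by auto
  have fz: "f \<star> z = z" using fg[symmetric] m X assoc[of f f g] by simp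
  have gz: "g \<star> z = z" using fg[symmetric] m X assoc[of f g g] commute[of g "f \<star> g"] closed by simp
  have fu: "f \<star> u = u" "g \<star> u = u"
    using X u m fz gz assoc[of f z u] assoc[of g z u] commute[of u z] by simp_all
  have gf: "g \<star> f = z" using fg commute X by simp
  show False
    by (rule no_square[of f g f g u z]) (use X u m fz gz fu fg gf n in auto)
qed

lemma nontrivial_group_below_idem:
  assumes e: "e \<in> idems" and z: "z \<in> idems" "z \<star> e = z" "z \<noteq> e" and f: "f \<in> idems" "e \<star> f = e" "e \<noteq> f"
    and u: "u \<in> carrier X" "unit_of u = e" "u \<noteq> e"
  shows False
proof -
  have X: "z \<in> carrier X" "f \<in> carrier X" "e \<in> carrier X" using z f e idems by auto
  have ue: "u \<star> e = u" "e \<star> u = u" "e \<star> e = e" "f \<star> f = f" "z \<star> z = z" using u e f z mult_unit_of[of u] idems by auto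
  have zf: "z \<star> f = z" using absorb_trans[of z e f] X z f by blast
  have uf: "u \<star> f = u" using absorb_trans[of u e f] X u ue f by blast
  have un: "unit_of (u \<star> u) = e" "unit_of f = f" "unit_of z = z" "unit_of e = e" "unit_of (z \<star> u) = z"
    using unit_of_mult unit_of_idem z f e ue u X by auto
  have fnz: "f \<noteq> z" using f z commute X by auto
  have n: "u \<star> u \<noteq> u" using cancel_unit u by metis
  show False
  proof (cases "z \<star> u = z")
    case True
    then have "u \<star> z = z" "e \<star> z = z" using commute X u z by auto
    then show False
      \<comment> \<open>Inside \<open>E\<close> are \<open>e\<close>, the square of
        \<open>u\<close>, and \<open>z\<close>; outside are \<open>u\<close> and
        \<open>f\<close>.\<close>
      by (intro no_square[of e u f u z f]) (use X u ue zf uf un n fnz f z commute[of f u] in auto)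
  next
    case False
    have vX: "z \<star> u \<in> carrier X" using X u closed by blast
    have m: "z \<star> (z \<star> u) = z \<star> u" "f \<star> (z \<star> u) = z \<star> u" "f \<star> u = u" "f \<star> e = e"
      using X u ue assoc[of z z u] assoc[of f z u] commute[of f z] zf uf commute[of f u] commute[of f e] f
      by simp_all
    have "z \<star> u \<noteq> u" "z \<star> u \<noteq> e" using un u z by auto
    moreover have "f \<noteq> u" using un u f by auto
    ultimately show False
      \<comment> \<open>Now \<open>u\<close> acts nontrivially on \<open>z\<close>: inside
        \<open>E\<close> are \<open>f\<close> and the product of \<open>z\<close> and
        \<open>u\<close>; outside are \<open>z\<close>, \<open>u\<close> and
        \<open>e\<close>.\<close>
      by (intro no_square[of z f u f "z \<star> u" e]) (use X u vX ue m un False fnz f z zf in auto)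
  qed
qed

text \<open>With \<open>P = Q = {e, u}\<close> the two multipliers \<open>z\<close> and
  \<open>f\<close> send the pair into two different groups below \<open>e\<close>, so one can lead
  into \<open>E\<close> and the other out of it.\<close>

lemma nontrivial_group_above_chain:
  assumes e: "e \<in> idems" and f: "f \<in> idems" "f \<star> e = f" "f \<noteq> e" and z: "z \<in> idems" "z \<star> f = z" "z \<noteq> f"
    and u: "u \<in> carrier X" "unit_of u = e" "u \<noteq> e"
  shows False
proof -
  have X: "z \<in> carrier X" "f \<in> carrier X" "e \<in> carrier X" using z f e idems by auto
  have ue: "u \<star> e = u" "e \<star> u = u" "e \<star> e = e" "f \<star> f = f" "z \<star> z = z" using u e f z mult_unit_of[of u] idems by auto
  have ze: "z \<star> e = z" using absorb_trans[of z f e] X z f by blast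
  then have ez: "e \<star> z = z" "e \<star> f = f" using commute X f by auto
  have un: "unit_of (u \<star> u) = e" "unit_of f = f" "unit_of z = z" "unit_of e = e"
    "unit_of (u \<star> z) = z" "unit_of (u \<star> f) = f"
    using unit_of_mult unit_of_idem z f e ue u X ez by auto
  have enz: "e \<noteq> z" using f z commute X by auto
  have n: "u \<star> u \<noteq> u" using cancel_unit u by metis
  have "u \<star> z \<noteq> u \<star> f" "u \<star> z \<noteq> f" "u \<star> z \<noteq> u" "z \<noteq> u \<star> f" "z \<noteq> u" "e \<noteq> u \<star> f" "u \<star> u \<noteq> u \<star> f" "u \<star> u \<noteq> f"
    using un u z f enz by auto
  then show False
    by (intro no_square[of e u e u z f]) (use X u ue ze ez n enz f z in auto)
qed

text \<open>If \<open>u\<close> fixed \<open>z\<close>, it would fix the whole group of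
  \<open>z\<close>, and \<open>z\<close> and \<open>v\<close> could serve as the two multipliers of
  a crossing with \<open>P = Q = {e, u}\<close>.\<close>

lemma two_groups_faithful:
  assumes e: "e \<in> idems" and z: "z \<in> idems" "z \<star> e = z" "z \<noteq> e"
    and u: "u \<in> carrier X" "unit_of u = e" "u \<noteq> e" and v: "v \<in> carrier X" "unit_of v = z" "v \<noteq> z"
  shows "u \<star> z \<noteq> z"
proof
  assume uz: "u \<star> z = z"
  have X: "z \<in> carrier X" "e \<in> carrier X" using z e idems by auto
  have ue: "u \<star> e = u" "e \<star> u = u" "e \<star> e = e" "z \<star> z = z" "z \<star> v = v" using u v e z mult_unit_of[of u] mult_unit_of[of v] idems by auto
  have ev: "e \<star> v = v" "u \<star> v = v" "e \<star> z = z"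
    using X u v ue uz z assoc[of e z v] assoc[of u z v] commute[of e z] by simp_all
  have un: "unit_of (u \<star> u) = e" "unit_of z = z" "unit_of e = e"
    using unit_of_mult unit_of_idem z e ue u X by auto
  have n: "u \<star> u \<noteq> u" using cancel_unit u by metis
  have "u \<star> u \<noteq> v" "e \<noteq> v" "z \<noteq> u" "z \<noteq> v" using un u v z by auto
  then show False
    by (intro no_square[of e u e u z v]) (use X u v ue ev uz n z in auto)
qed

text \<open>For an incomparable pair, a second lower bound \<open>z\<close> below the meet separates
  the two multipliers: \<open>f\<close>, \<open>g\<close>, \<open>z\<close> lie in \<open>E\<close>,
  the meet outside.\<close>

lemma meet_minimal:
  assumes z: "z \<in> idems" and f: "f \<in> idems" and g: "g \<in> idems" and "f \<star> g \<noteq> f" "f \<star> g \<noteq> g" "z \<star> (f \<star> g) = z"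
  shows "z = f \<star> g"
proof (rule ccontr)
  assume n: "z \<noteq> f \<star> g"
  let ?e = "f \<star> g"
  have X: "z \<in> carrier X" "f \<in> carrier X" "g \<in> carrier X" "?e \<in> carrier X" using z f g idems closed by auto
  have m: "f \<star> f = f" "g \<star> g = g" "g \<star> f = ?e" using f g idems commute X by auto
  have fe: "f \<star> ?e = ?e" "g \<star> ?e = ?e" "?e \<star> f = ?e" "?e \<star> g = ?e"
    using X m assoc[of f f g] left_commute[of g f g] commute[of ?e f] commute[of ?e g] by simp_all
  have "f \<star> z = z" "g \<star> z = z"
    using absorb_trans[of z ?e f] absorb_trans[of z ?e g] X assms fe commute by metis+
  then show False
    by (intro no_square[of f g f g z ?e]) (use X m fe n assms in auto)
qed

text \<open>The upper bound \<open>c\<close> multiplies \<open>a\<close> and \<open>b\<close> to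
  themselves, their meet multiplies both to itself; for an incomparable pair these values are
  disjoint.\<close>

lemma lower_set_chain:
  assumes a: "a \<in> idems" and b: "b \<in> idems" and c: "c \<in> idems" and "a \<star> c = a" "b \<star> c = b"
  shows "a \<star> b = a \<or> a \<star> b = b"
proof (rule ccontr)
  assume n: "\<not> ?thesis"
  let ?d = "a \<star> b"
  have X: "a \<in> carrier X" "b \<in> carrier X" "c \<in> carrier X" "?d \<in> carrier X" using a b c idems closed by auto
  have m: "a \<star> a = a" "b \<star> b = b" "b \<star> a = ?d" using a b idems commute X by auto
  have fe: "a \<star> ?d = ?d" "b \<star> ?d = ?d"
    using X m assoc[of a a b] left_commute[of b a b] by simp_all
  show False
    by (intro no_square[of a b a b c ?d]) (use X m fe n assms in auto)
qed

end

context uncrossed_semigroup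
begin

subsection \<open>Groups and chains\<close>

text \<open>With \<open>P = Q = {e, a}\<close>, the multipliers \<open>r\<close> and
  \<open>s\<close> produce cosets of \<open>{e, a}\<close>. A third coset would keep these disjoint,
  so the group has at most four elements.\<close>

lemma involution_group:
  assumes a: "a \<in> carrier X" "unit_of a = e" "a \<noteq> e" "a \<star> a = e"
    and r: "r \<in> carrier X" "unit_of r = e" "r \<notin> {e, a}"
    and s: "s \<in> carrier X" "unit_of s = e"
  shows "s \<in> {e, a, r, a \<star> r}"
proof (rule ccontr)
  assume n: "s \<notin> {e, a, r, a \<star> r}"
  have e: "e \<in> idems" "e \<in> carrier X" "e \<star> e = e" using unit_of_in_idems[OF a(1)] a(2) idems by auto
  have m: "e \<star> a = a" "a \<star> e = a" "e \<star> r = r" "e \<star> s = s"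
    using mult_unit_of[of a] mult_unit_of[of r] mult_unit_of[of s] a r s by auto
  have "a \<star> s \<noteq> e" using cancel[of a s a] a s n by auto
  moreover have "a \<star> (a \<star> s) = s" using assoc[of a a s] a s m by simp
  then have "a \<star> s \<noteq> r" using n by auto
  moreover have "a \<star> s \<noteq> a \<star> r" using cancel[of a s r] a r s n by auto
  moreover have "a \<star> r \<noteq> a" using cancel_unit[of a r] a r by auto
  ultimately show False
    by (intro no_square[of e a e a r s]) (use a e r s m n in auto)
qed

text \<open>The same square with the multiplier \<open>r\<close> taken to be the square of
  \<open>a\<close>: an \<open>s\<close> off this list would make both \<open>s\<close> and its
  product with \<open>a\<close> avoid the identity and the second and third powers of
  \<open>a\<close>.\<close>

lemma noninvolution_group:
  assumes a: "a \<in> carrier X" "unit_of a = e" "a \<star> a \<noteq> e"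
    and b: "b \<in> carrier X" "unit_of b = e" "a \<star> b = e"
    and s: "s \<in> carrier X" "unit_of s = e"
  shows "s \<in> {e, a, a \<star> a, a \<star> (a \<star> a), b}"
proof (rule ccontr)
  assume n: "s \<notin> {e, a, a \<star> a, a \<star> (a \<star> a), b}"
  have e: "e \<in> idems" "e \<in> carrier X" "e \<star> e = e" using unit_of_in_idems[OF a(1)] a(2) idems by auto
  have a2: "a \<star> a \<in> carrier X" "unit_of (a \<star> a) = e" using a closed unit_of_mult e by auto
  have m: "e \<star> a = a" "a \<star> e = a" "e \<star> s = s" "e \<star> (a \<star> a) = a \<star> a"
    using mult_unit_of[of a] mult_unit_of[of s] mult_unit_of[of "a \<star> a"] a s a2 by auto
  have ae: "a \<noteq> e" using a e by auto
  have "a \<star> s \<noteq> e" using cancel[of a s b] a b s n by auto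
  moreover have "a \<star> s \<noteq> a \<star> a" using cancel[of a s a] a s n by auto
  moreover have "a \<star> s \<noteq> a \<star> (a \<star> a)" using cancel[of a s "a \<star> a"] a a2 s n by auto
  moreover have "a \<star> a \<noteq> a" "a \<star> (a \<star> a) \<noteq> a" using cancel_unit[of a a] cancel_unit[of a "a \<star> a"] a a2 ae by auto
  ultimately show False
    by (intro no_square[of e a e a "a \<star> a" s]) (use a e s m n a2 ae in auto)
qed

text \<open>Otherwise the bound of five elements is attained and \<open>a\<close> has order five.
  The crossing then has \<open>e\<close> and the inverse of \<open>a\<close> inside
  \<open>E\<close>, and \<open>a\<close> and its cube \<open>d\<close> outside; the square of
  \<open>d\<close> is \<open>a\<close> again.\<close>

lemma no_group_of_order_5:
  assumes a: "a \<in> carrier X" "unit_of a = e" "a \<star> a \<noteq> e"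
    and b: "b \<in> carrier X" "unit_of b = e" "a \<star> b = e"
  shows "a \<star> (a \<star> a) \<in> {e, b}"
proof (rule ccontr)
  define c where "c = a \<star> a"
  define d where "d = a \<star> c"
  assume "a \<star> (a \<star> a) \<notin> {e, b}"
  then have n: "d \<noteq> e" "d \<noteq> b" unfolding c_def d_def by auto
  have e: "e \<in> idems" "e \<in> carrier X" "e \<star> e = e" using unit_of_in_idems[OF a(1)] a(2) idems by auto
  have c: "c \<in> carrier X" "unit_of c = e" unfolding c_def using a closed unit_of_mult e by auto
  have d: "d \<in> carrier X" "unit_of d = e" unfolding d_def using a c closed unit_of_mult e by auto
  have m: "e \<star> a = a" "a \<star> e = a" "e \<star> b = b" "e \<star> d = d" "d \<star> e = d"
    using mult_unit_of[of a] mult_unit_of[of b] mult_unit_of[of d] a b d by auto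
  have ae: "a \<noteq> e" "b \<noteq> a" using a b e by auto
  have ad: "a \<star> d \<in> carrier X" "unit_of (a \<star> d) = e" using a d closed unit_of_mult e by auto
  have "a \<star> d \<in> {e, a, c, d, b}" using noninvolution_group[OF a b ad] unfolding c_def d_def .
  moreover have "a \<star> d \<noteq> e" using cancel[of a d b] a b d n by auto
  moreover have "a \<star> d \<noteq> a" using cancel_unit[of a d] a d n by auto
  moreover have "d \<noteq> a" using cancel_unit[of a c] a c unfolding d_def c_def by auto
  then have "a \<star> d \<noteq> c" unfolding c_def using cancel[of a d a] a d by auto
  moreover have "c \<noteq> a" using cancel_unit[of a a] a ae unfolding c_def by auto
  then have "d \<noteq> c" using cancel[of a c a] a c unfolding c_def d_def by auto
  then have "a \<star> d \<noteq> d" using cancel[of a d c] a c d unfolding d_def by auto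
  ultimately have adb: "a \<star> d = b" by blast
  have "d \<star> d = c \<star> (a \<star> d)" using a c d assoc[of a c d] left_commute[of a c d] unfolding d_def by simp
  also have "\<dots> = a" using adb a b assoc[of a a b] m unfolding c_def by simp
  finally have "d \<star> d = a" .
  then show False
    by (intro no_square[of e a e d b d]) (use a b d e m n ae adb \<open>d \<noteq> a\<close> in auto)
qed

lemma cyclic_isomorphism:
  fixes g :: "nat \<Rightarrow> 'a"
  assumes "n > 0" and e: "\<And>x. x \<in> carrier X \<Longrightarrow> e \<star> x = x" and a: "a \<in> carrier X"
    and g: "g 0 = e" "\<And>i. g (Suc i) = a \<star> g i" "g n = e"
    and X: "carrier X = g ` {..<n}" and inj: "inj_on g {..<n}"
  shows "isomorphic X (cyclic_group n)"
proof -
  have eX: "e \<in> carrier X" unfolding X using \<open>n > 0\<close> g(1) by (intro image_eqI[of _ _ 0]) auto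
  have gX: "g i \<in> carrier X" for i by (induction i) (use g eX a closed in auto)
  have add: "g (i + j) = g i \<star> g j" for i j
    by (induction i) (use g e gX a assoc in auto)
  have mul: "g (n * k) = e" for k
    by (induction k) (use g add e eX in auto)
  have md: "g (i mod n) = g i" for i
  proof -
    have "g i = g (n * (i div n)) \<star> g (i mod n)" using add[of "n * (i div n)" "i mod n"] by simp
    then show ?thesis using mul e gX by simp
  qed
  have "isomorphic (residues_magma n) X"
    unfolding isomorphic_def residues_magma_def
    using inj X md add by (intro exI[of _ g]) (auto simp: bij_betw_def)
  moreover have "closed_magma (residues_magma n)"
    using \<open>n > 0\<close> unfolding closed_magma_def residues_magma_def by simp
  ultimately show ?thesis
    using isomorphic_sym isomorphic_trans residues_magma_isomorphic_cyclic_group[OF \<open>n > 0\<close>] by blast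
qed

lemma isomorphic_klein:
  assumes X: "carrier X = {e, a, r, a \<star> r}" and d: "distinct [e, a, r, a \<star> r]"
    and e: "\<And>x. x \<in> carrier X \<Longrightarrow> e \<star> x = x" and sq: "a \<star> a = e" "r \<star> r = e"
  shows "isomorphic X (direct_product (cyclic_group 2) (cyclic_group 2))"
proof -
  \<comment> \<open>A sign is read as an exponent: \<open>1\<close> selects the identity and
    \<open>-1\<close> the involution.\<close>
  let ?h = "\<lambda>b (s::complex). if s = 1 then e else b"
  let ?g = "\<lambda>(s, t). ?h a s \<star> ?h r t"
  let ?Y = "direct_product (cyclic_group 2) (cyclic_group 2)"
  have mem: "e \<in> carrier X" "a \<in> carrier X" "r \<in> carrier X" unfolding X by auto
  then have m: "e \<star> e = e" "e \<star> a = a" "e \<star> r = r" "a \<star> e = a" "r \<star> e = r"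
    using e commute[of _ e] by simp_all
  have Y: "carrier ?Y = {(1,1),(1,-1),(-1,1),(-1,-1)}"
    by (auto simp: direct_product_def carrier_cyclic_group_2)
  have "?g ` carrier ?Y = carrier X" unfolding Y X by (auto simp: m)
  moreover have "inj_on ?g (carrier ?Y)" unfolding Y using d by (auto simp: inj_on_def m)
  moreover have "?g (x \<star>\<^bsub>?Y\<^esub> y) = ?g x \<star> ?g y" if "x \<in> carrier ?Y" "y \<in> carrier ?Y" for x y
  proof -
    obtain s t s' t' where [simp]: "x = (s,t)" "y = (s',t')" by fastforce
    have st: "s \<in> {1,-1}" "t \<in> {1,-1}" "s' \<in> {1,-1}" "t' \<in> {1,-1}" using that unfolding Y by auto
    have "?h a (s * s') = ?h a s \<star> ?h a s'" "?h r (t * t') = ?h r t \<star> ?h r t'"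
      using st by (auto simp: m sq)
    moreover have "(?h a s \<star> ?h a s') \<star> (?h r t \<star> ?h r t') = (?h a s \<star> ?h r t) \<star> (?h a s' \<star> ?h r t')"
      by (rule swap) (use mem in auto)
    ultimately show ?thesis by (simp add: direct_product_def sop_cyclic_group)
  qed
  ultimately have "isomorphic ?Y X" unfolding isomorphic_def bij_betw_def by blast
  then show ?thesis
  proof (rule isomorphic_sym)
    show "closed_magma ?Y" unfolding closed_magma_def direct_product_def
      by (auto simp: carrier_cyclic_group_2 sop_cyclic_group)
  qed
qed

lemma group_classification:
  assumes un: "\<And>x. x \<in> carrier X \<Longrightarrow> unit_of x = e"
    and a: "a \<in> carrier X" "a \<noteq> e" and c: "c \<in> carrier X" "c \<noteq> e" "c \<noteq> a"
  shows "isomorphic X (cyclic_group 3) \<or> isomorphic X (cyclic_group 4) \<or>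
    isomorphic X (direct_product (cyclic_group 2) (cyclic_group 2))"
proof -
  have e: "e \<in> carrier X" "e \<star> e = e" using unit_of_in_idems[OF a(1)] un[OF a(1)] idems by auto
  have id: "e \<star> x = x" "x \<star> e = x" if "x \<in> carrier X" for x using mult_unit_of[OF that] un[OF that] by auto
  show ?thesis
  proof (cases "\<forall>x\<in>carrier X. x \<star> x = e")
    case True
    have "carrier X = {e, a, c, a \<star> c}"
      using involution_group[of a e c] a c un True e closed by auto
    moreover have "distinct [e, a, c, a \<star> c]"
      using a c e un True cancel[of a c a] cancel_unit[of a c] cancel_unit[of c a] commute[of a c] by auto
    ultimately show ?thesis using isomorphic_klein[of e a c] id True a c by auto
  next
    case False
    then obtain x where x: "x \<in> carrier X" "x \<star> x \<noteq> e" by blast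
    obtain b where b: "b \<in> carrier X" "x \<star> b = e" using inverse_ex[OF x(1)] un[OF x(1)] by metis
    have sub: "carrier X \<subseteq> {e, x, x \<star> x, x \<star> (x \<star> x), b}"
      using noninvolution_group[of x e b] x b un by blast
    have xX: "x \<star> x \<in> carrier X" "x \<star> (x \<star> x) \<in> carrier X" using x closed by auto
    have ne: "x \<noteq> e" "x \<star> x \<noteq> x" "x \<star> (x \<star> x) \<noteq> x \<star> x" "x \<star> (x \<star> x) \<noteq> x"
      using x e un cancel_unit[of x x] cancel[of x "x \<star> x" x] cancel_unit[of x "x \<star> x"] xX by auto
    let ?g = "\<lambda>i. (((\<star>) x) ^^ i) e"
    have g: "?g 0 = e" "\<And>i. ?g (Suc i) = x \<star> ?g i" by auto
    have "x \<star> (x \<star> x) \<in> {e, b}" using no_group_of_order_5[of x e b] x b un by blast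
    then show ?thesis
    proof
      assume 3: "x \<star> (x \<star> x) = e"
      then have "b = x \<star> x" using cancel[of x b "x \<star> x"] x b xX un by auto
      then have "carrier X = {e, x, x \<star> x}" using sub 3 e x xX by auto
      then have "carrier X = ?g ` {..<3}" "inj_on ?g {..<3}"
        using ne x id by (auto simp: numeral_3_eq_3 lessThan_Suc)
      moreover have "?g 3 = e" using 3 x id by (simp add: numeral_3_eq_3)
      ultimately have "isomorphic X (cyclic_group 3)"
        by (intro cyclic_isomorphism[of 3 e x ?g]) (use id x in auto)
      then show ?thesis by blast
    next
      assume "x \<star> (x \<star> x) \<in> {b}"
      then have 4: "x \<star> (x \<star> x) = b" by simp
      then have be: "b \<noteq> e" "x \<star> (x \<star> (x \<star> x)) = e" using b x id by auto
      have "carrier X = {e, x, x \<star> x, x \<star> (x \<star> x)}" using sub 4 e x xX by auto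
      then have "carrier X = ?g ` {..<4}" "inj_on ?g {..<4}"
        using ne x id be 4 by (auto simp: eval_nat_numeral lessThan_Suc)
      moreover have "?g 4 = e" using be x id by (simp add: eval_nat_numeral)
      ultimately have "isomorphic X (cyclic_group 4)"
        by (intro cyclic_isomorphism[of 4 e x ?g]) (use id x in auto)
      then show ?thesis by blast
    qed
  qed
qed

section \<open>Chain conditions and finiteness of chains\<close>

text \<open>Any two terms have a common later term of either parity. In an ascending sequence the
  product with it is the earlier factor, so \<open>E\<close> consists of the even terms; in a
  descending one it is the later factor, so \<open>E\<close> consists of the odd terms.\<close>

lemma no_alternating_sequence:
  fixes x :: "nat \<Rightarrow> 'a"
  assumes X: "\<And>i. x i \<in> carrier X" and inj: "inj x"
    and mono: "(\<forall>i j. i < j \<longrightarrow> x i \<star> x j = x i) \<or> (\<forall>i j. i < j \<longrightarrow> x i \<star> x j = x j)"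
  shows False
proof -
  have half: "half_crossing X E (x ` {i. p i}) (x ` {i. q i})"
    if p: "\<And>i j. \<lbrakk>p i; q j; i < j\<rbrakk> \<Longrightarrow> x i \<star> x j \<in> E" and q: "\<And>n. \<exists>j>n. q j" for p q E
    unfolding half_crossing_def
  proof (intro conjI ballI)
    fix a assume "a \<in> x ` {i. p i}"
    then obtain i where "p i" "a = x i" by blast
    moreover obtain j where "j > i" "q j" using q by blast
    ultimately show "\<exists>q\<in>x ` {i. q i}. a \<star> q \<in> E" using p by blast
  next
    fix a a' assume "a \<in> x ` {i. p i}" "a' \<in> x ` {i. p i}"
    then obtain i i' where i: "p i" "a = x i" "p i'" "a' = x i'" by blast
    obtain j where "j > max i i'" "q j" using q by blast
    then show "\<exists>w\<in>carrier X. a \<star> w \<in> E \<and> a' \<star> w \<in> E"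
      using i p X by (intro bexI[of _ "x j"]) auto
  qed
  have evens: "\<exists>j>n. even j" and odds: "\<exists>j>n. odd j" for n :: nat
    by (rule exI[of _ "2 * n + 2"], simp) (rule exI[of _ "2 * n + 1"], simp)
  have mem: "x i \<in> x ` A \<longleftrightarrow> i \<in> A" for i A using inj by (rule inj_image_mem_iff)
  let ?P = "x ` {i. even i}" and ?Q = "x ` {i. odd i}"
  have sub: "?P \<noteq> {}" "?P \<subseteq> carrier X" "?Q \<subseteq> carrier X" using X even_zero by blast+
  from mono show False
  proof
    assume m: "\<forall>i j. i < j \<longrightarrow> x i \<star> x j = x i"
    have "half_crossing X ?P ?P ?Q" by (rule half) (use m odds in auto)
    moreover have "half_crossing X (- ?P) ?Q ?P" by (rule half) (use m evens in \<open>auto simp: mem\<close>)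
    ultimately have "crossing X ?P ?P ?Q" unfolding crossing_def using sub by blast
    then show False using uncrossed unfolding crossed_def by blast
  next
    assume m: "\<forall>i j. i < j \<longrightarrow> x i \<star> x j = x j"
    have "half_crossing X ?Q ?P ?Q" by (rule half) (use m odds in auto)
    moreover have "half_crossing X (- ?Q) ?Q ?P" by (rule half) (use m evens in \<open>auto simp: mem\<close>)
    ultimately have "crossing X ?Q ?P ?Q" unfolding crossing_def using sub by blast
    then show False using uncrossed unfolding crossed_def by blast
  qed
qed

text \<open>The order \<open>R\<close> is left abstract to serve ascending and descending sequences
  alike.\<close>

lemma strict_chain:
  fixes x :: "nat \<Rightarrow> 'a"
  assumes x: "\<And>i. x i \<in> idems" and step: "\<And>i. R (x i) (x (Suc i)) \<and> x i \<noteq> x (Suc i)"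
    and trans: "\<And>a b c. \<lbrakk>a \<in> idems; b \<in> idems; c \<in> idems; R a b; R b c\<rbrakk> \<Longrightarrow> R a c"
    and antisym: "\<And>a b. \<lbrakk>a \<in> idems; b \<in> idems; R a b; R b a\<rbrakk> \<Longrightarrow> a = b"
  shows "i < j \<Longrightarrow> R (x i) (x j)" "inj x"
proof -
  have lt: "R (x i) (x j) \<and> x i \<noteq> x j" if "i < j" for i j
    using that
  proof (induction rule: less_Suc_induct)
    case (1 i)
    then show ?case using step by blast
  next
    case (2 i j k)
    then show ?case using trans[OF x x x, of i j k] antisym[OF x x, of i j] by auto
  qed
  show "i < j \<Longrightarrow> R (x i) (x j)" using lt by blast
  show "inj x" using lt by (metis injI linorder_neqE_nat)
qed

lemma idems_trans: "\<lbrakk>a \<in> idems; b \<in> idems; c \<in> idems; a \<star> b = a; b \<star> c = b\<rbrakk> \<Longrightarrow> a \<star> c = a"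
  using absorb_trans idems by blast

lemma idems_antisym: "\<lbrakk>a \<in> idems; b \<in> idems; a \<star> b = a; b \<star> a = b\<rbrakk> \<Longrightarrow> a = b"
  using commute idems by metis

text \<open>Without a maximal member, dependent choice builds a strictly ascending sequence of
  idempotents, which is impossible.\<close>

lemma maximal_idem_ex:
  assumes "A \<subseteq> idems" "A \<noteq> {}"
  shows "\<exists>m\<in>A. \<forall>b\<in>A. m \<star> b = m \<longrightarrow> b = m"
proof (rule ccontr)
  assume n: "\<not> ?thesis"
  have "\<exists>x::nat \<Rightarrow> 'a. \<forall>i. x i \<in> A \<and> (x i \<star> x (Suc i) = x i \<and> x i \<noteq> x (Suc i))"
    using assms(2) n by (intro dependent_nat_choice[of "\<lambda>_ a. a \<in> A" "\<lambda>_ a b. a \<star> b = a \<and> a \<noteq> b"]) (blast, metis)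
  then obtain x :: "nat \<Rightarrow> 'a" where x: "\<And>i. x i \<in> A" "\<And>i. x i \<star> x (Suc i) = x i \<and> x i \<noteq> x (Suc i)"
    by blast
  then have xi: "x i \<in> idems" for i using assms(1) by blast
  have ch: "x i \<star> x j = x i" if "i < j" for i j
    by (rule strict_chain(1)[of x "\<lambda>a b. a \<star> b = a" i j, OF xi x(2) _ _ that])
      (fact idems_trans, fact idems_antisym)
  have inj: "inj x"
    by (rule strict_chain(2)[of x "\<lambda>a b. a \<star> b = a", OF xi x(2)])
      (fact idems_trans, fact idems_antisym)
  have "\<forall>i j. i < j \<longrightarrow> x i \<star> x j = x i" using ch by simp
  then show False using no_alternating_sequence[OF idems(1)[OF xi] inj] by simp
qed

lemma minimal_idem_ex:
  assumes "A \<subseteq> idems" "A \<noteq> {}"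
  shows "\<exists>m\<in>A. \<forall>b\<in>A. b \<star> m = b \<longrightarrow> b = m"
proof (rule ccontr)
  assume n: "\<not> ?thesis"
  have "\<exists>x::nat \<Rightarrow> 'a. \<forall>i. x i \<in> A \<and> (x (Suc i) \<star> x i = x (Suc i) \<and> x i \<noteq> x (Suc i))"
    using assms(2) n by (intro dependent_nat_choice[of "\<lambda>_ a. a \<in> A" "\<lambda>_ a b. b \<star> a = b \<and> a \<noteq> b"]) (blast, metis)
  then obtain x :: "nat \<Rightarrow> 'a" where x: "\<And>i. x i \<in> A" "\<And>i. x (Suc i) \<star> x i = x (Suc i) \<and> x i \<noteq> x (Suc i)"
    by blast
  then have xi: "x i \<in> idems" for i using assms(1) by blast
  have tr: "c \<star> a = c" if "a \<in> idems" "b \<in> idems" "c \<in> idems" "b \<star> a = b" "c \<star> b = c" for a b c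
    using idems_trans[of c b a] that by blast
  have an: "a = b" if "a \<in> idems" "b \<in> idems" "b \<star> a = b" "a \<star> b = a" for a b
    using idems_antisym[of a b] that by blast
  have ch: "x j \<star> x i = x j" if "i < j" for i j
    by (rule strict_chain(1)[of x "\<lambda>a b. b \<star> a = b" i j, OF xi x(2) _ _ that]) (fact tr, fact an)
  have inj: "inj x"
    by (rule strict_chain(2)[of x "\<lambda>a b. b \<star> a = b", OF xi x(2)]) (fact tr, fact an)
  have "\<forall>i j. i < j \<longrightarrow> x i \<star> x j = x j"
    using ch commute[OF idems(1)[OF xi] idems(1)[OF xi]] by metis
  then show False using no_alternating_sequence[OF idems(1)[OF xi] inj] by simp
qed

text \<open>Both chain conditions are used. Let \<open>t\<close> be maximal among the elements with
  finitely many elements below, and \<open>w\<close> minimal among those not below \<open>t\<close>.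
  The elements below \<open>w\<close> are \<open>w\<close> and some below \<open>t\<close>, so
  \<open>w\<close> contradicts the choice of \<open>t\<close>.\<close>

lemma finite_chain:
  assumes D: "D \<subseteq> idems" and ch: "\<And>a b. \<lbrakk>a \<in> D; b \<in> D\<rbrakk> \<Longrightarrow> a \<star> b = a \<or> a \<star> b = b"
  shows "finite D"
proof (rule ccontr)
  assume inf: "infinite D"
  have DX: "D \<subseteq> carrier X" using D idems by blast
  define I where "I = {c \<in> D. finite {d \<in> D. d \<star> c = d}}"
  have ch': "a \<star> b = a \<or> b \<star> a = b" if "a \<in> D" "b \<in> D" for a b
    using ch[OF that] commute[of a b] that DX by (metis subsetD)
  have "D \<noteq> {}" using inf by auto
  then obtain m where m: "m \<in> D" "\<forall>b\<in>D. b \<star> m = b \<longrightarrow> b = m" using minimal_idem_ex[OF D] by blast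
  then have "{d \<in> D. d \<star> m = d} \<subseteq> {m}" by blast
  then have "m \<in> I" using m(1) finite_subset unfolding I_def by blast
  moreover have "I \<subseteq> idems" using D unfolding I_def by blast
  ultimately obtain t where t: "t \<in> I" "\<forall>b\<in>I. t \<star> b = t \<longrightarrow> b = t" using maximal_idem_ex[of I] by blast
  have tD: "t \<in> D" "finite {d \<in> D. d \<star> t = d}" using t unfolding I_def by auto
  let ?A = "D - {d \<in> D. d \<star> t = d}"
  have "?A \<noteq> {}" using inf tD(2) by (metis Diff_eq_empty_iff finite_subset)
  moreover have "?A \<subseteq> idems" using D by blast
  ultimately obtain w where w: "w \<in> ?A" "\<forall>b\<in>?A. b \<star> w = b \<longrightarrow> b = w" using minimal_idem_ex[of ?A] by blast
  have "{d \<in> D. d \<star> w = d} \<subseteq> insert w {d \<in> D. d \<star> t = d}" using w by blast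
  then have "finite {d \<in> D. d \<star> w = d}" using tD(2) by (meson finite.insertI finite_subset)
  then have "w \<in> I" using w unfolding I_def by blast
  moreover have "t \<star> w = t" using ch'[of t w] w tD by blast
  ultimately have "w = t" using t by blast
  then show False using w tD D idems by blast
qed

lemma chain_rank:
  assumes D: "D \<subseteq> idems" and ch: "\<And>a b. \<lbrakk>a \<in> D; b \<in> D\<rbrakk> \<Longrightarrow> a \<star> b = a \<or> a \<star> b = b"
  obtains r where "bij_betw r D {0..<card D}" "\<And>a b. \<lbrakk>a \<in> D; b \<in> D\<rbrakk> \<Longrightarrow> r (a \<star> b) = min (r a) (r b)"
proof -
  \<comment> \<open>The rank of an element is the number of elements strictly below it.\<close>
  define L where "L a = {d \<in> D. d \<star> a = d \<and> d \<noteq> a}" for a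
  let ?r = "\<lambda>a. card (L a)"
  have fin: "finite D" by (rule finite_chain[OF D ch])
  have lt: "?r a < ?r b" if ab: "a \<in> D" "b \<in> D" "a \<star> b = a" "a \<noteq> b" for a b
  proof (rule psubset_card_mono)
    show "finite (L b)" using fin unfolding L_def by simp
    have "d \<star> b = d \<and> d \<noteq> b" if "d \<in> D" "d \<star> a = d" "d \<noteq> a" for d
      using idems_trans[of d a b] idems_antisym[of a b] that ab D by blast
    then have "L a \<subseteq> L b" unfolding L_def by blast
    moreover have "a \<in> L b" "a \<notin> L a" using ab unfolding L_def by blast+
    ultimately show "L a \<subset> L b" by blast
  qed
  have cm: "b \<star> a = a \<star> b" if "a \<in> D" "b \<in> D" for a b using that D idems commute by blast
  have min: "?r (a \<star> b) = min (?r a) (?r b)" if ab: "a \<in> D" "b \<in> D" for a b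
    using ch[OF ab] lt[OF ab] lt[OF ab(2,1)] cm[OF ab] by (cases "a = b") auto
  have inj: "inj_on ?r D"
  proof (rule inj_onI, rule ccontr)
    fix a b assume "a \<in> D" "b \<in> D" "?r a = ?r b" "a \<noteq> b"
    then show False using ch[of a b] lt[of a b] lt[of b a] cm[of a b] by auto
  qed
  have "?r a < card D" if "a \<in> D" for a
    by (rule psubset_card_mono[OF fin]) (use that in \<open>auto simp: L_def\<close>)
  then have "?r ` D \<subseteq> {0..<card D}" by auto
  moreover have "card (?r ` D) = card {0..<card D}" using card_image[OF inj] by simp
  ultimately have "?r ` D = {0..<card D}" by (intro card_subset_eq) auto
  then show ?thesis using that[of ?r] inj min unfolding bij_betw_def by blast
qed

end

lemma isomorphic_L1_union_C2:
  assumes S: "S = {z, e, w}" "z \<noteq> e" "z \<noteq> w" "e \<noteq> w"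
    and m: "z \<star>\<^bsub>X\<^esub> z = z" "z \<star>\<^bsub>X\<^esub> e = z" "z \<star>\<^bsub>X\<^esub> w = z" "e \<star>\<^bsub>X\<^esub> z = z" "w \<star>\<^bsub>X\<^esub> z = z"
      "e \<star>\<^bsub>X\<^esub> e = e" "e \<star>\<^bsub>X\<^esub> w = w" "w \<star>\<^bsub>X\<^esub> e = w" "w \<star>\<^bsub>X\<^esub> w = e"
  shows "isomorphic (X\<lparr>carrier := S\<rparr>) (ordered_union (linear_semilattice 1) (cyclic_group 2))"
proof -
  let ?f = "\<lambda>x. if x = z then Inl (0::nat) else if x = e then Inr 1 else Inr (-1 :: complex)"
  let ?Y = "ordered_union (linear_semilattice 1) (cyclic_group 2)"
  have Y: "carrier ?Y = {Inl 0, Inr 1, Inr (-1)}"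
    by (auto simp: ordered_union_def carrier_cyclic_group_2 linear_semilattice_def)
  have "?f ` S = carrier ?Y" unfolding Y S(1) using S by auto
  moreover have "inj_on ?f S" using S by (auto simp: inj_on_def)
  moreover have "?f (x \<star>\<^bsub>X\<^esub> y) = ?f x \<star>\<^bsub>?Y\<^esub> ?f y" if "x \<in> S" "y \<in> S" for x y
  proof -
    have "x = z \<or> x = e \<or> x = w" "y = z \<or> y = e \<or> y = w" using that S(1) by blast+
    then show ?thesis
      using S(2-4) by (elim disjE) (simp_all add: m ordered_union_def linear_semilattice_def sop_cyclic_group)
  qed
  ultimately have "\<exists>f. bij_betw f S (carrier ?Y) \<and> (\<forall>x\<in>S. \<forall>y\<in>S. f (x \<star>\<^bsub>X\<^esub> y) = f x \<star>\<^bsub>?Y\<^esub> f y)"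
    unfolding bij_betw_def by blast
  then show ?thesis unfolding isomorphic_def by simp
qed

context uncrossed_semigroup
begin

lemma chain_isomorphic:
  assumes "D \<subseteq> idems" "D \<noteq> {}" "\<And>a b. \<lbrakk>a \<in> D; b \<in> D\<rbrakk> \<Longrightarrow> a \<star> b = a \<or> a \<star> b = b"
  shows "\<exists>n\<ge>1. isomorphic (X\<lparr>carrier := D\<rparr>) (linear_semilattice n)"
proof -
  obtain r where r: "bij_betw r D {0..<card D}" "\<And>a b. \<lbrakk>a \<in> D; b \<in> D\<rbrakk> \<Longrightarrow> r (a \<star> b) = min (r a) (r b)"
    using chain_rank[OF assms(1,3)] by blast
  obtain d where "d \<in> D" using assms(2) by blast
  then have "r d < card D" using r(1) bij_betwE by fastforce
  then have "1 \<le> card D" by simp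
  moreover have "isomorphic (X\<lparr>carrier := D\<rparr>) (linear_semilattice (card D))"
    unfolding isomorphic_def linear_semilattice_def using r by (intro exI[of _ r]) auto
  ultimately show ?thesis by blast
qed

text \<open>The meet of a minimal idempotent with any other lies below the minimal one, hence equals
  it.\<close>

lemma least_idem_ex: "\<exists>z\<in>idems. \<forall>e\<in>idems. z \<star> e = z"
proof -
  obtain x where "x \<in> carrier X" using nonempty by blast
  then have "idems \<noteq> {}" using unit_of_in_idems by blast
  then obtain z where z: "z \<in> idems" "\<forall>b\<in>idems. b \<star> z = b \<longrightarrow> b = z"
    using minimal_idem_ex[of idems] by blast
  have "z \<star> e = z" if e: "e \<in> idems" for e
  proof -
    have "(z \<star> e) \<star> z = z \<star> e"
      using z(1) e idems assoc[of z e z] assoc[of z z e] commute[of e z] by simp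
    then show ?thesis using z idems_mult[OF z(1) e] by blast
  qed
  then show ?thesis using z(1) by blast
qed

text \<open>A second idempotent is above \<open>e\<close>, or its meet with \<open>e\<close> is
  strictly below \<open>e\<close>; both are excluded next to a group with three elements.\<close>

lemma large_group_is_everything:
  assumes a: "a \<in> carrier X" "unit_of a = e" "a \<noteq> e" and c: "c \<in> carrier X" "unit_of c = e" "c \<noteq> e" "c \<noteq> a"
    and x: "x \<in> carrier X"
  shows "unit_of x = e"
proof (rule ccontr)
  assume n: "unit_of x \<noteq> e"
  let ?f = "unit_of x"
  have e: "e \<in> idems" and f: "?f \<in> idems" using unit_of_in_idems a x by auto
  show False
  proof (cases "e \<star> ?f = e")
    case True
    then show False using big_group_no_idem_above[OF e f _ _ a c] n by auto
  next
    case False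
    have "(e \<star> ?f) \<star> e = e \<star> ?f"
      using e f idems assoc[of e ?f e] assoc[of e e ?f] commute[of ?f e] by simp
    then show False using big_group_no_idem_below[OF e idems_mult[OF e f] _ _ a c] False by auto
  qed
qed

end

section \<open>Components of the semilattice\<close>

text \<open>The situation once larger groups are settled: \<open>small\<close> bounds every maximal
  subgroup by two elements.\<close>

locale small_uncrossed_semigroup = uncrossed_semigroup +
  fixes z :: 'a
  assumes small: "\<lbrakk>a \<in> carrier X; c \<in> carrier X; unit_of a = unit_of c; a \<noteq> unit_of a; c \<noteq> unit_of c\<rbrakk> \<Longrightarrow> a = c"
    and zI: "z \<in> idems" and z_least: "e \<in> idems \<Longrightarrow> z \<star> e = z"
begin

lemma z_carrier: "z \<in> carrier X" and z_unit: "unit_of z = z"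
  using zI idems unit_of_idem by auto

lemma z_least': "e \<in> idems \<Longrightarrow> e \<star> z = z"
  using z_least commute idems zI by metis

lemma square_unit: assumes u: "u \<in> carrier X" shows "u \<star> u = unit_of u"
proof (cases "u = unit_of u")
  case True
  then show ?thesis using mult_unit_of[OF u] by simp
next
  case False
  let ?w = "u \<star> u"
  have "unit_of ?w = unit_of u" "?w \<in> carrier X"
    using u unit_of_mult idems unit_of_in_idems closed by auto
  moreover have "?w \<noteq> u" using cancel_unit[of u u] u False by auto
  ultimately show ?thesis using small[of ?w u] u False by auto
qed

text \<open>By \<open>meet_minimal\<close> the meet of an incomparable pair has nothing strictly
  below it, so it is the least idempotent.\<close>

lemma not_comparable: "\<lbrakk>f \<in> idems; g \<in> idems; f \<star> g \<noteq> z\<rbrakk> \<Longrightarrow> f \<star> g = f \<or> f \<star> g = g"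
  using meet_minimal[OF zI, of f g] z_least idems_mult by metis

text \<open>The nontrivial group at \<open>z\<close> makes all idempotents a chain. A second
  nontrivial group leaves room for just two idempotents; otherwise everything above the kernel is
  idempotent and acts on it as an identity.\<close>

lemma kernel_chain_isomorphic:
  assumes v: "v \<in> carrier X" "unit_of v = z" "v \<noteq> z"
  shows "isomorphic X (cyclic_group 2) \<or>
     isomorphic X (direct_product (cyclic_group 2) (linear_semilattice 2)) \<or>
     (\<exists>n\<ge>1. isomorphic X (ordered_union (cyclic_group 2) (linear_semilattice n)))"
proof -
  have chain: "f \<star> g = f \<or> f \<star> g = g" if "f \<in> idems" "g \<in> idems" for f g
    using not_comparable[OF that] kernel_group_chain[OF zI v that] that z_least z_least' by metis
  have vv: "v \<star> v = z" "z \<star> v = v" "v \<star> z = v" "z \<star> z = z"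
    using square_unit[OF v(1)] mult_unit_of[OF v(1)] v zI idems by auto
  have kernel: "x = z \<or> x = v" if "x \<in> carrier X" "unit_of x = z" for x
    using small[of x v] v that by auto
  show ?thesis
  proof (cases "\<exists>u\<in>carrier X. unit_of u \<noteq> z \<and> u \<noteq> unit_of u")
    case True
    then obtain u where u: "u \<in> carrier X" "unit_of u \<noteq> z" "u \<noteq> unit_of u" by blast
    define e where "e = unit_of u"
    have ue: "unit_of u = e" "u \<noteq> e" "z \<noteq> e" using u unfolding e_def by auto
    have e: "e \<in> idems" "e \<in> carrier X" using u unit_of_in_idems idems unfolding e_def by auto
    have uz: "unit_of (u \<star> z) = z" using unit_of_mult u z_carrier z_unit ue z_least'[OF e(1)] by simp
    have uzv: "u \<star> z = v"
      using kernel[OF _ uz] two_groups_faithful[OF e(1) zI z_least[OF e(1)] ue(3) u(1) ue(1,2) v] u z_carrier closed by blast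
    \<comment> \<open>A third idempotent would lie above \<open>e\<close>, or strictly between
      \<open>z\<close> and \<open>e\<close>; the nontrivial group at \<open>e\<close> rules out
      both.\<close>
    have two: "f = z \<or> f = e" if f: "f \<in> idems" for f
    proof (rule ccontr)
      assume n: "\<not> (f = z \<or> f = e)"
      from chain[OF e(1) f] show False
      proof
        assume "e \<star> f = e"
        then show False
          using nontrivial_group_below_idem[OF e(1) zI z_least[OF e(1)] ue(3) f _ _ u(1) ue(1,2)] n by auto
      next
        assume "e \<star> f = f"
        then have "f \<star> e = f" using commute e f idems by metis
        then show False
          using nontrivial_group_above_chain[OF e(1) f _ _ zI z_least[OF f] _ u(1) ue(1,2)] n by auto
      qed
    qed
    have X: "carrier X = {z, v, e, u}"
    proof -
      have "x \<in> {z, v, e, u}" if x: "x \<in> carrier X" for x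
        using two[OF unit_of_in_idems[OF x]] kernel[OF x] small[of x u] x u ue by auto
      then show ?thesis using z_carrier v e u by blast
    qed
    have m: "e \<star> e = e" "e \<star> u = u" "u \<star> e = u" "u \<star> u = e" "z \<star> e = z" "e \<star> z = z" "z \<star> u = v"
      using e u ue idems mult_unit_of[of u] square_unit[of u] z_least z_least' uzv commute[of z u] z_carrier by auto
    let ?h = "\<lambda>s::complex. if s = 1 then e else u"
    let ?k = "\<lambda>i::nat. if i = 0 then z else e"
    let ?g = "\<lambda>(s, i). ?h s \<star> ?k i"
    let ?Y = "direct_product (cyclic_group 2) (linear_semilattice 2)"
    have Y: "carrier ?Y = {(1,0),(1,1),(-1,0),(-1,1)}"
      by (auto simp: direct_product_def carrier_cyclic_group_2 linear_semilattice_def)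
    have d: "v \<noteq> e" "u \<noteq> z" "u \<noteq> v" using v e ue unit_of_idem z_unit by auto
    have "?g ` carrier ?Y = carrier X" unfolding Y X by (auto simp: m uzv)
    moreover have "inj_on ?g (carrier ?Y)" unfolding Y using d ue v by (auto simp: inj_on_def m uzv)
    moreover have "?g (x \<star>\<^bsub>?Y\<^esub> y) = ?g x \<star> ?g y" if "x \<in> carrier ?Y" "y \<in> carrier ?Y" for x y
    proof -
      obtain s t s' t' where [simp]: "x = (s,t)" "y = (s',t')" by fastforce
      have st: "s \<in> {1,-1}" "t \<in> {0,1}" "s' \<in> {1,-1}" "t' \<in> {0,1}" using that unfolding Y by auto
      have "?h (s * s') = ?h s \<star> ?h s'" "?k (min t t') = ?k t \<star> ?k t'"
        using st by (auto simp: m vv)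
      moreover have "(?h s \<star> ?h s') \<star> (?k t \<star> ?k t') = (?h s \<star> ?k t) \<star> (?h s' \<star> ?k t')"
        by (rule swap) (use e u z_carrier in auto)
      ultimately show ?thesis by (simp add: direct_product_def sop_cyclic_group linear_semilattice_def)
    qed
    ultimately have "isomorphic ?Y X" unfolding isomorphic_def bij_betw_def by blast
    moreover have "closed_magma ?Y" unfolding closed_magma_def direct_product_def
      by (auto simp: carrier_cyclic_group_2 sop_cyclic_group linear_semilattice_def)
    ultimately show ?thesis using isomorphic_sym by blast
  next
    case False
    then have triv: "unit_of x = x" if "x \<in> carrier X" "unit_of x \<noteq> z" for x using that by auto
    let ?D = "idems - {z}"
    have X: "carrier X = {z, v} \<union> ?D"
    proof -
      have "x \<in> {z, v} \<union> ?D" if x: "x \<in> carrier X" for x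
        using triv[OF x] kernel[OF x] unit_of_in_idems[OF x] by fastforce
      then show ?thesis using z_carrier v idems by blast
    qed
    have vD: "v \<notin> ?D" using v unit_of_idem by auto
    have m: "z \<star> d = z" "d \<star> z = z" "v \<star> d = v" "d \<star> v = v" if "d \<in> idems" for d
    proof -
      show "z \<star> d = z" "d \<star> z = z" using z_least z_least' that by auto
      show "v \<star> d = v" using absorb_trans[of v z d] vv z_least that v z_carrier idems by blast
      then show "d \<star> v = v" using commute[of d v] that v idems by simp
    qed
    show ?thesis
    proof (cases "?D = {}")
      case True
      have X2: "carrier X = {z, v}" using X unfolding True by simp
      let ?g = "\<lambda>i. (((\<star>) v) ^^ i) z"
      have "isomorphic X (cyclic_group 2)"
        by (rule cyclic_isomorphism[of 2 z v ?g])
          (use X2 v vv in \<open>auto simp: numeral_2_eq_2 lessThan_Suc\<close>)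
      then show ?thesis by blast
    next
      case False
      obtain r where r: "bij_betw r ?D {0..<card ?D}" "\<And>a b. \<lbrakk>a \<in> ?D; b \<in> ?D\<rbrakk> \<Longrightarrow> r (a \<star> b) = min (r a) (r b)"
        using chain_rank[of ?D] chain by blast
      define n where "n = card ?D"
      have "n \<ge> 1" unfolding n_def
        using False finite_chain[of ?D] chain by (metis Diff_subset DiffD1 One_nat_def Suc_leI card_gt_0_iff)
      let ?f = "\<lambda>x. if x = z then Inl 1 else if x = v then Inl (-1 :: complex) else Inr (r x)"
      let ?Y = "ordered_union (cyclic_group 2) (linear_semilattice n)"
      have Y: "carrier ?Y = {Inl 1, Inl (-1)} \<union> Inr ` {0..<n}"
        by (auto simp: ordered_union_def carrier_cyclic_group_2 linear_semilattice_def)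
      have fD: "?f x = Inr (r x)" if "x \<in> ?D" for x using that vD by auto
      have fzv: "?f z = Inl 1" "?f v = Inl (-1)" using v by auto
      have rD: "r ` ?D = {0..<n}" "inj_on r ?D" using r(1) unfolding bij_betw_def n_def by auto
      have im: "?f ` ?D = Inr ` {0..<n}" unfolding rD(1)[symmetric] image_image using fD by (intro image_cong) auto
      have "?f ` carrier X = carrier ?Y"
        unfolding X Y image_Un im image_insert fzv image_empty ..
      moreover have "inj_on ?f (carrier X)"
        unfolding X using v rD(2) vD by (auto simp: inj_on_def)
      moreover have "?f (x \<star> y) = ?f x \<star>\<^bsub>?Y\<^esub> ?f y" if "x \<in> carrier X" "y \<in> carrier X" for x y
      proof -
        have xy: "x = z \<or> x = v \<or> x \<in> ?D" "y = z \<or> y = v \<or> y \<in> ?D" using that X by blast+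
        have Ym: "sop ?Y = ordered_union_op (cyclic_group 2) (linear_semilattice n)"
          by (simp add: ordered_union_def)
        have DD: "?f (x \<star> y) = Inr (min (r x) (r y))" if "x \<in> ?D" "y \<in> ?D"
        proof -
          have "x \<star> y \<in> ?D" using chain[of x y] that by auto
          then show ?thesis using fD r(2) that by simp
        qed
        from xy show ?thesis
          unfolding Ym
          by (elim disjE)
            (simp_all only: fzv fD DD, simp_all add: m vv v(3) sop_cyclic_group linear_semilattice_def)
      qed
      ultimately have "isomorphic X ?Y" unfolding isomorphic_def bij_betw_def by blast
      then show ?thesis using \<open>n \<ge> 1\<close> by blast
    qed
  qed
qed

definition related :: "'a \<Rightarrow> 'a \<Rightarrow> bool" where
  "related x y \<longleftrightarrow> unit_of x \<star> unit_of y \<noteq> z"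

text \<open>The component of \<open>z\<close> is \<open>{z}\<close>, a copy of \<open>L_1\<close>;
  so the components cover the carrier even when it has one element.\<close>

definition component :: "'a \<Rightarrow> 'a set" where
  "component x = insert z {y \<in> carrier X. related x y}"

lemma related_sym: "\<lbrakk>x \<in> carrier X; y \<in> carrier X; related x y\<rbrakk> \<Longrightarrow> related y x"
  unfolding related_def using commute unit_of_in_idems idems by metis

text \<open>Each nonzero meet makes its pair comparable. If \<open>a\<close> and \<open>c\<close>
  are both below \<open>b\<close>, they are comparable by \<open>lower_set_chain\<close>; if both
  are above, \<open>b\<close> bounds their meet from below; the other two cases are chains.\<close>

lemma nonzero_meet_trans:
  assumes a: "a \<in> idems" and b: "b \<in> idems" and c: "c \<in> idems"
    and ab: "a \<star> b \<noteq> z" and bc: "b \<star> c \<noteq> z"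
  shows "a \<star> c \<noteq> z"
proof
  assume ac: "a \<star> c = z"
  have X: "a \<in> carrier X" "b \<in> carrier X" "c \<in> carrier X" using a b c idems by auto
  have nz: "a \<noteq> z" "b \<noteq> z" "c \<noteq> z" using ab bc z_least z_least' a b c by auto
  have cb: "c \<star> b = b \<star> c" using commute X by blast
  from not_comparable[OF a b ab] not_comparable[OF b c bc] show False
  proof (elim disjE)
    assume "a \<star> b = a" "b \<star> c = b"
    then show False using idems_trans[OF a b c] ac nz by simp
  next
    assume "a \<star> b = a" "b \<star> c = c"
    then show False using lower_set_chain[OF a c b] ac nz cb by simp
  next
    assume h: "a \<star> b = b" "b \<star> c = b"
    have "b = (a \<star> b) \<star> c" using h by simp
    also have "\<dots> = b \<star> (a \<star> c)" using X assoc[of a b c] left_commute[of a b c] by simp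
    finally show False using ac z_least'[OF b] nz by simp
  next
    assume h: "a \<star> b = b" "b \<star> c = c"
    have "a \<star> c = (a \<star> b) \<star> c" using X h assoc[of a b c] by simp
    then show False using ac h nz by simp
  qed
qed

lemma related_trans:
  "\<lbrakk>x \<in> carrier X; y \<in> carrier X; w \<in> carrier X; related x y; related y w\<rbrakk> \<Longrightarrow> related x w"
  unfolding related_def using nonzero_meet_trans unit_of_in_idems by blast

lemma component_eq:
  assumes "x \<in> carrier X" "y \<in> carrier X" "related x y"
  shows "component x = component y"
proof -
  have "related x w \<longleftrightarrow> related y w" if "w \<in> carrier X" for w
    using related_trans[of x y w] related_trans[of y x w] related_sym[of x y] assms that by blast
  then show ?thesis unfolding component_def by auto
qed

context
  assumes trivial_kernel: "\<lbrakk>x \<in> carrier X; unit_of x = z\<rbrakk> \<Longrightarrow> x = z"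
begin

text \<open>A product with \<open>z\<close> has unit \<open>z\<close>, and the group at
  \<open>z\<close> is trivial.\<close>

lemma is_zero_z: "is_zero X z"
proof -
  have "z \<star> x = z" if x: "x \<in> carrier X" for x
    by (rule trivial_kernel)
      (use unit_of_mult[OF z_carrier x] z_unit z_least unit_of_in_idems[OF x] closed[OF z_carrier x] in auto)
  then show ?thesis unfolding is_zero_def using z_carrier commute by metis
qed

lemma zero_mult: "x \<in> carrier X \<Longrightarrow> z \<star> x = z" "x \<in> carrier X \<Longrightarrow> x \<star> z = z"
  using is_zero_z unfolding is_zero_def by auto

lemma unit_nonzero: "\<lbrakk>x \<in> carrier X; x \<noteq> z\<rbrakk> \<Longrightarrow> unit_of x \<noteq> z"
  using trivial_kernel by blast

lemma related_refl: "\<lbrakk>x \<in> carrier X; x \<noteq> z\<rbrakk> \<Longrightarrow> related x x"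
  unfolding related_def using unit_nonzero idems unit_of_in_idems by simp

lemma mem_component: "x \<in> carrier X \<Longrightarrow> x \<in> component x"
  unfolding component_def using related_refl by blast

lemma component_subset: "component x \<subseteq> carrier X"
  unfolding component_def using z_carrier by blast

lemma component_memD:
  assumes "x \<in> carrier X" "t \<in> component x" "t \<noteq> z"
  shows "t \<in> carrier X" "component t = component x" "related x t"
proof -
  show t: "t \<in> carrier X" "related x t" using assms unfolding component_def by auto
  show "component t = component x" using component_eq[OF assms(1) t] by simp
qed

lemma related_of_mult: assumes "t \<in> carrier X" "s \<in> carrier X" "t \<star> s \<noteq> z" shows "related t s"
  unfolding related_def using unit_of_mult[OF assms(1,2)] unit_nonzero[of "t \<star> s"] closed assms by auto

lemma component_subsemigroup:
  assumes x: "x \<in> carrier X" shows "subsemigroup (component x) X"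
proof -
  have "t \<star> s \<in> component x" if ts: "t \<in> component x" "s \<in> component x" for t s
  proof (cases "t \<star> s = z")
    case True
    then show ?thesis unfolding component_def by simp
  next
    case False
    have c: "t \<in> carrier X" "s \<in> carrier X" using ts component_subset by auto
    then have tz: "t \<noteq> z" "s \<noteq> z" using False zero_mult by auto
    have "related t s" using related_of_mult c False by blast
    \<comment> \<open>Related units are comparable, so their meet is one of them and the product
      stays related to \<open>x\<close>.\<close>
    then have "unit_of (t \<star> s) = unit_of t \<or> unit_of (t \<star> s) = unit_of s"
      using not_comparable unit_of_mult c unit_of_in_idems unfolding related_def by simp
    then have "related x (t \<star> s)"
      using component_memD(3)[OF x ts(1) tz(1)] component_memD(3)[OF x ts(2) tz(2)]
      unfolding related_def by auto
    then show ?thesis unfolding component_def using closed c by simp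
  qed
  then show ?thesis using component_subset mem_component[OF x] unfolding subsemigroup_def by blast
qed

text \<open>The bouquet is indexed by the components themselves, so distinct indices are distinct
  classes of \<open>related\<close>, and a nonzero product would relate its factors.\<close>

lemma zero_bouquet_components: "zero_bouquet X (component ` carrier X) (\<lambda>S. S)"
proof -
  have "S \<inter> T = {z} \<and> {s \<star> t | s t. s \<in> S \<and> t \<in> T} = {z}"
    if ST: "S \<in> component ` carrier X" "T \<in> component ` carrier X" "S \<noteq> T" for S T
  proof -
    obtain x y where xy: "x \<in> carrier X" "S = component x" "y \<in> carrier X" "T = component y"
      using ST by blast
    have zS: "z \<in> S" "z \<in> T" unfolding xy component_def by auto
    have "w = z" if "w \<in> S" "w \<in> T" for w
      using component_memD(2)[of x w] component_memD(2)[of y w] xy that \<open>S \<noteq> T\<close> by auto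
    then have 1: "S \<inter> T = {z}" using zS by blast
    have 2: "s \<star> t = z" if st: "s \<in> S" "t \<in> T" for s t
    proof (rule ccontr)
      assume n: "s \<star> t \<noteq> z"
      have c: "s \<in> carrier X" "t \<in> carrier X" using st component_subset xy by auto
      then have tz: "s \<noteq> z" "t \<noteq> z" using n zero_mult by auto
      have "component s = component t" using component_eq[OF c] related_of_mult[OF c n] by simp
      then show False
        using component_memD(2)[of x s] component_memD(2)[of y t] xy st tz \<open>S \<noteq> T\<close> by auto
    qed
    have "{s \<star> t | s t. s \<in> S \<and> t \<in> T} \<subseteq> {z}" using 2 by auto
    moreover have "z \<in> {s \<star> t | s t. s \<in> S \<and> t \<in> T}" using 2[OF zS] zS by (intro CollectI exI[of _ z]) simp
    ultimately show ?thesis using 1 by auto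
  qed
  moreover have "carrier X = (\<Union>S\<in>component ` carrier X. S)"
    using mem_component component_subset by auto
  moreover have "\<forall>S\<in>component ` carrier X. subsemigroup S X" using component_subsemigroup by auto
  ultimately show ?thesis unfolding zero_bouquet_def using is_zero_z by (intro conjI exI[of _ z]) auto
qed

text \<open>A nonidempotent \<open>w\<close> tolerates no idempotent of its component besides
  \<open>z\<close> and its own unit: one above the unit, or strictly between it and
  \<open>z\<close>, is excluded. Without such a \<open>w\<close> the component consists of pairwise
  comparable idempotents.\<close>

lemma component_isomorphic:
  assumes x: "x \<in> carrier X"
  shows "isomorphic (X\<lparr>carrier := component x\<rparr>) (ordered_union (linear_semilattice 1) (cyclic_group 2)) \<or>
    (\<exists>n\<ge>1. isomorphic (X\<lparr>carrier := component x\<rparr>) (linear_semilattice n))"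
proof (cases "\<exists>w\<in>component x. unit_of w \<noteq> w")
  case True
  then obtain w where w: "w \<in> component x" "unit_of w \<noteq> w" by blast
  define e where "e = unit_of w"
  have wX: "w \<in> carrier X" using w component_subset by blast
  have wz: "w \<noteq> z" using w z_unit by auto
  have we: "unit_of w = e" "w \<noteq> e" using w unfolding e_def by auto
  have e: "e \<in> idems" "e \<in> carrier X" "unit_of e = e" using unit_of_in_idems[OF wX] idems unit_of_idem we by auto
  have ez: "z \<noteq> e" using unit_nonzero[OF wX wz] we by simp
  have eq: "component w = component x" by (rule component_memD(2)[OF x w(1) wz])
  have "e \<in> component w"
    unfolding component_def related_def using e we idems(2)[OF e(1)] ez by simp
  moreover have "z \<in> component w" "w \<in> component w"
    using w(1) eq unfolding component_def by simp_all
  moreover have "t \<in> {z, e, w}" if t: "t \<in> component w" for t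
  proof (rule ccontr)
    assume n: "t \<notin> {z, e, w}"
    let ?f = "unit_of t"
    have tX: "t \<in> carrier X" and rel: "e \<star> ?f \<noteq> z"
      using component_memD[OF wX t] n we unfolding related_def by auto
    have f: "?f \<in> idems" "z \<noteq> ?f" using unit_of_in_idems unit_nonzero[OF tX] tX n by auto
    have "?f \<noteq> e" using small[OF tX wX] n we by auto
    from not_comparable[OF e(1) f(1) rel] show False
    proof
      assume "e \<star> ?f = e"
      then show False
        using nontrivial_group_below_idem[OF e(1) zI z_least[OF e(1)] ez f(1) _ _ wX we] \<open>?f \<noteq> e\<close> by auto
    next
      assume "e \<star> ?f = ?f"
      then have "?f \<star> e = ?f" using commute e f idems by metis
      then show False
        using nontrivial_group_above_chain[OF e(1) f(1) _ \<open>?f \<noteq> e\<close> zI z_least[OF f(1)] f(2) wX we] by auto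
    qed
  qed
  ultimately have S: "component w = {z, e, w}" by (intro subset_antisym subsetI) auto
  have "isomorphic (X\<lparr>carrier := component w\<rparr>) (ordered_union (linear_semilattice 1) (cyclic_group 2))"
    by (rule isomorphic_L1_union_C2[OF S])
      (use ez wz we zero_mult z_carrier wX e idems(2)[OF e(1)] mult_unit_of[OF wX] square_unit[OF wX] in auto)
  then show ?thesis using eq by simp
next
  case False
  have id: "t \<in> idems" "unit_of t = t" if "t \<in> component x" for t
    using False that unit_of_in_idems component_subset by (metis subsetD)+
  have "s \<star> t = s \<or> s \<star> t = t" if st: "s \<in> component x" "t \<in> component x" for s t
  proof (cases "s = z \<or> t = z")
    case True
    then show ?thesis using zero_mult st component_subset by auto
  next
    case False
    have c: "s \<in> carrier X" "t \<in> carrier X" using st component_subset by auto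
    have "related s t"
      using related_trans[of s x t] related_sym[of x s] component_memD(3)[OF x] st False c x by blast
    then show ?thesis using not_comparable[of s t] id st unfolding related_def by simp
  qed
  then have "\<exists>n\<ge>1. isomorphic (X\<lparr>carrier := component x\<rparr>) (linear_semilattice n)"
    by (intro chain_isomorphic) (use id mem_component[OF x] in auto)
  then show ?thesis by blast
qed

end

end

section \<open>The classification assembled\<close>

text \<open>The ordered union of \<open>L_1\<close> and \<open>C_2\<close> is missing from the first
  list because its kernel group is trivial, so it appears among the bouquets.\<close>

lemma (in uncrossed_semigroup) classification:
  "(isomorphic X (cyclic_group 2) \<or>
     isomorphic X (cyclic_group 3) \<or>
     isomorphic X (cyclic_group 4) \<or>
     isomorphic X (direct_product (cyclic_group 2) (cyclic_group 2)) \<or>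
     isomorphic X (direct_product (cyclic_group 2) (linear_semilattice 2)) \<or>
     (\<exists>n\<ge>1. isomorphic X (ordered_union (cyclic_group 2) (linear_semilattice n)))) \<or>
    (\<exists>(I :: 'a set set) (S :: 'a set \<Rightarrow> 'a set). zero_bouquet X I S \<and>
       (\<forall>i\<in>I. isomorphic (X\<lparr>carrier := S i\<rparr>) (ordered_union (linear_semilattice 1) (cyclic_group 2)) \<or>
              (\<exists>n\<ge>1. isomorphic (X\<lparr>carrier := S i\<rparr>) (linear_semilattice n))))"
proof (cases "\<exists>a\<in>carrier X. \<exists>c\<in>carrier X. unit_of a = unit_of c \<and> a \<noteq> unit_of a \<and> c \<noteq> unit_of c \<and> c \<noteq> a")
  case True
  then obtain a c where a: "a \<in> carrier X" "a \<noteq> unit_of a"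
    and c: "c \<in> carrier X" "unit_of c = unit_of a" "c \<noteq> unit_of a" "c \<noteq> a" by auto
  have "unit_of x = unit_of a" if "x \<in> carrier X" for x
    using large_group_is_everything[OF a(1) refl a(2) c that] .
  then show ?thesis using group_classification[OF _ a c(1,3,4)] by blast
next
  case False
  obtain z where z: "z \<in> idems" "\<And>e. e \<in> idems \<Longrightarrow> z \<star> e = z" using least_idem_ex by blast
  interpret small_uncrossed_semigroup X z
    by unfold_locales (use False z in auto)
  show ?thesis
  proof (cases "\<exists>v\<in>carrier X. unit_of v = z \<and> v \<noteq> z")
    case True
    then show ?thesis using kernel_chain_isomorphic by blast
  next
    case False
    then have tk: "x = z" if "x \<in> carrier X" "unit_of x = z" for x using that by blast
    have "zero_bouquet X (component ` carrier X) (\<lambda>S. S)"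
      by (rule zero_bouquet_components) (rule tk)
    moreover have "\<forall>S\<in>component ` carrier X.
        isomorphic (X\<lparr>carrier := S\<rparr>) (ordered_union (linear_semilattice 1) (cyclic_group 2)) \<or>
        (\<exists>n\<ge>1. isomorphic (X\<lparr>carrier := S\<rparr>) (linear_semilattice n))"
      using component_isomorphic[OF tk] by simp
    ultimately show ?thesis
      by (intro disjI2 exI[of _ "component ` carrier X"] exI[of _ "\<lambda>S. S"] conjI)
  qed
qed

theorem theorem9p5:
  fixes X :: "'a magma"
  assumes "carrier_semigroup X"
    and "regular X"
  shows "commutative (superextension X) \<longleftrightarrow>
    (isomorphic X (cyclic_group 2) \<or>
     isomorphic X (cyclic_group 3) \<or>
     isomorphic X (cyclic_group 4) \<or>
     isomorphic X (direct_product (cyclic_group 2) (cyclic_group 2)) \<or>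
     isomorphic X (direct_product (cyclic_group 2) (linear_semilattice 2)) \<or>
     isomorphic X (ordered_union (linear_semilattice 1) (cyclic_group 2)) \<or>
     (\<exists>n::nat. n \<ge> 1 \<and> isomorphic X (ordered_union (cyclic_group 2) (linear_semilattice n)))) \<or>
    (\<exists>(I :: 'a set set) (S :: 'a set \<Rightarrow> 'a set).
       zero_bouquet X I S \<and>
       (\<forall>i\<in>I. isomorphic (X\<lparr>carrier := S i\<rparr>) (ordered_union (linear_semilattice 1) (cyclic_group 2)) \<or>
              (\<exists>n::nat. n \<ge> 1 \<and> isomorphic (X\<lparr>carrier := S i\<rparr>) (linear_semilattice n))))"
    (is "_ \<longleftrightarrow> ?G \<or> ?B")
proof -
  interpret carrier_semigroup X by fact
  have cl: "closed_magma X" unfolding closed_magma_def using closed by blast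
  have "commutative X \<and> \<not> crossed X \<longleftrightarrow> ?G \<or> ?B"
  proof
    assume h: "commutative X \<and> \<not> crossed X"
    interpret uncrossed_semigroup X
      by unfold_locales (use h assms(2) in \<open>auto simp: commutative_def regular_def\<close>)
    show "?G \<or> ?B" using classification by blast
  next
    have transfer: "commutative X \<and> \<not> crossed X"
      if "isomorphic X Y" "commutative Y" "\<not> crossed Y" for Y :: "'b magma"
      using isomorphic_commutative[OF that(1) cl that(2)] isomorphic_crossed[OF that(1) cl] that(3) by blast
    have transfer_bouquet: "commutative X \<and> \<not> crossed X"
      if zb: "zero_bouquet X I S"
        and iso: "\<forall>i\<in>I. isomorphic (X\<lparr>carrier := S i\<rparr>) (ordered_union (linear_semilattice 1) (cyclic_group 2)) \<or>
              (\<exists>n\<ge>1. isomorphic (X\<lparr>carrier := S i\<rparr>) (linear_semilattice n))"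
      for I :: "'a set set" and S :: "'a set \<Rightarrow> 'a set"
    proof -
      note models = commutative_ordered_union[OF commutative_linear_semilattice commutative_cyclic_group]
        commutative_linear_semilattice not_crossed_L1_union_C2 not_crossed_Ln
      have "commutative (X\<lparr>carrier := S i\<rparr>) \<and> \<not> crossed (X\<lparr>carrier := S i\<rparr>)" if i: "i \<in> I" for i
      proof -
        have "subsemigroup (S i) X" using zb i unfolding zero_bouquet_def by simp
        then have c: "closed_magma (X\<lparr>carrier := S i\<rparr>)"
          unfolding closed_magma_def subsemigroup_def by simp
        from iso[rule_format, OF i] show ?thesis
        proof (elim disjE exE conjE)
          assume *: "isomorphic (X\<lparr>carrier := S i\<rparr>) (ordered_union (linear_semilattice 1) (cyclic_group 2))"
          show ?thesis
            using isomorphic_commutative[OF * c models(1)] isomorphic_crossed[OF * c] models(3) by blast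
        next
          fix n assume *: "isomorphic (X\<lparr>carrier := S i\<rparr>) (linear_semilattice n)"
          show ?thesis
            using isomorphic_commutative[OF * c models(2)] isomorphic_crossed[OF * c] models(4) by blast
        qed
      qed
      then show ?thesis using bouquet_commutative_not_crossed[OF zb] by blast
    qed
    assume "?G \<or> ?B"
    then show "commutative X \<and> \<not> crossed X"
      by (elim disjE exE conjE)
        ((erule transfer;
          intro commutative_cyclic_group commutative_linear_semilattice commutative_direct_product
            commutative_ordered_union not_crossed_C2 not_crossed_C3 not_crossed_C4 not_crossed_klein
            not_crossed_C2_times_L2 not_crossed_L1_union_C2 not_crossed_C2_union_Ln)
        | (erule transfer_bouquet, assumption))+
  qed
  then show ?thesis using commutative_superextension_iff[OF assms(1)] by blast
qed

end
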